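(* Let $(G_n)_n$ be a sequence of finite simple graphs which is convergent in the dense model, i.e. for every fixed finite simple graph $F$ the sequence $\hom(F,G_n)/v(G_n)^{v(F)}$ converges. Let $\pi_n$ be the uniform probability measure on the multiset of roots of the matching polynomial $\mu(G_n,x)$. Then the rescaled measures $$\lambda_n(X):=\pi_n\left(\sqrt{v(G_n)}\,X\right),\qquad X\subseteq\mathbb{R},$$ converge weakly.
   Context: $v(G)$ denotes the number of vertices of $G$ and $\hom(F,G)$ the number of graph homomorphisms from $F$ to $G$. For a graph $G$ on $n$ vertices, let $m_k(G)$ be the number of matchings with $k$ edges in $G$ ($m_0(G)=1$). The matching polynomial is $\mu(G,x)=\sum_{k=0}^{\lfloor n/2\rfloor}(-1)^k m_k(G)x^{n-2k}$, a polynomial of degree $n$ all of whose roots are real (Heilmann–Lieb); $\pi_n$ puts mass $1/v(G_n)$ on each root, counted with multiplicity. For $c>0$, $cX=\{cx:x\in X\}$.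
   Formalization: The formal theorem additionally assumes v(G_n) → ∞; without it the claim fails, e.g. for the sequence alternating between K_2 and K_{2,2}, whose homomorphism densities all agree but whose rescaled root measures differ. *)

theory Defs
  imports "HOL-Probability.Probability" "Graph_Theory.Pair_Digraph"
begin

text \<open>
  Finite simple graphs are the digraphs satisfying \<^const>\<open>pair_graph\<close>: finite, loop-free, with a
  symmetric arc relation and no parallel arcs. An undirected edge \<open>{u, v}\<close> is represented
  by the two arcs \<open>(u, v)\<close> and \<open>(v, u)\<close>.
\<close>

definition vert_num :: "'a pair_pre_digraph \<Rightarrow> nat" where
  "vert_num G = card (pverts G)"

definition undirected_edges :: "'a pair_pre_digraph \<Rightarrow> 'a set set" where
  "undirected_edges G = {{u, v} | u v. (u, v) \<in> parcs G}"

text \<open>Extensional function spaces make the set of homomorphisms finite and free of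
  duplicates differing only outside the vertex set of \<open>F\<close>.\<close>

definition graph_homs :: "'a pair_pre_digraph \<Rightarrow> 'b pair_pre_digraph \<Rightarrow> ('a \<Rightarrow> 'b) set" where
  "graph_homs F G =
     {f \<in> pverts F \<rightarrow>\<^sub>E pverts G. \<forall>(u, v) \<in> parcs F. (f u, f v) \<in> parcs G}"

definition hom_num :: "'a pair_pre_digraph \<Rightarrow> 'b pair_pre_digraph \<Rightarrow> nat" where
  "hom_num F G = card (graph_homs F G)"

text \<open>Test graphs \<open>F\<close> with natural-number vertices represent all finite simple graphs up to
  isomorphism. Densities are invariant under blow-ups, whereas matching polynomials are not
  (compare \<open>K_2\<close> with \<open>K_{2,2}\<close>), so this condition is meaningful for roots of matching
  polynomials only in combination with the usual requirement that the number of vertices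
  tends to infinity.\<close>

definition dense_convergent :: "(nat \<Rightarrow> 'a pair_pre_digraph) \<Rightarrow> bool" where
  "dense_convergent G \<longleftrightarrow>
     (\<forall>F :: nat pair_pre_digraph. pair_graph F \<longrightarrow>
        convergent (\<lambda>n. real (hom_num F (G n)) / real (vert_num (G n)) ^ vert_num F))"

definition matchings :: "'a pair_pre_digraph \<Rightarrow> nat \<Rightarrow> 'a set set set" where
  "matchings G k = {M. M \<subseteq> undirected_edges G \<and> pairwise disjnt M \<and> card M = k}"

definition matching_poly :: "'a pair_pre_digraph \<Rightarrow> real poly" where
  "matching_poly G =
     (\<Sum>k = 0..vert_num G div 2.
        monom ((-1) ^ k * real (card (matchings G k))) (vert_num G - 2 * k))"

text \<open>All roots of \<^term>\<open>matching_poly G\<close> are real by the Heilmann--Lieb theorem, so the real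
  roots, counted with multiplicity, carry total mass 1 when \<open>G\<close> has a vertex.\<close>

definition root_measure :: "'a pair_pre_digraph \<Rightarrow> real measure" where
  "root_measure G =
     distr (point_measure UNIV
       (\<lambda>x. ennreal (real (count (proots (matching_poly G)) x) / real (vert_num G))))
     borel (\<lambda>x. x)"

text \<open>The push-forward under division by \<open>c = sqrt (vert_num G)\<close> assigns to \<open>X\<close> the mass of
  \<open>c X\<close>; see \<open>emeasure_rescaled_root_measure\<close> below.\<close>

definition rescaled_root_measure :: "'a pair_pre_digraph \<Rightarrow> real measure" where
  "rescaled_root_measure G =
     distr (root_measure G) borel (\<lambda>x. x / sqrt (real (vert_num G)))"

lemma emeasure_root_measure:
  assumes "X \<in> sets borel"
  shows "emeasure (root_measure G) X =
    ennreal (real (size (filter_mset (\<lambda>x. x \<in> X) (proots (matching_poly G)))) / real (vert_num G))"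
proof -
  define R where "R = proots (matching_poly G)"
  define f where "f x = ennreal (real (count R x) / real (vert_num G))" for x
  have f_supp: "x \<in># R" if "0 < f x" for x
    using that by (cases "x \<in># R") (auto simp: f_def not_in_iff)
  have "emeasure (root_measure G) X = emeasure (point_measure UNIV f) X"
    using assms unfolding root_measure_def R_def[symmetric] f_def[symmetric]
    by (subst emeasure_distr) auto
  also have "\<dots> = (\<Sum>x | x \<in> X \<and> 0 < f x. f x)"
    by (rule emeasure_point_measure) (use f_supp in \<open>auto intro: finite_subset[of _ "set_mset R"]\<close>)
  also have "\<dots> = (\<Sum>x\<in>set_mset (filter_mset (\<lambda>x. x \<in> X) R). f x)"
    using f_supp by (intro sum.mono_neutral_left) (auto simp: zero_less_iff_neq_zero)
  also have "\<dots> = ennreal (\<Sum>x\<in>set_mset (filter_mset (\<lambda>x. x \<in> X) R). real (count R x) / real (vert_num G))"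
    unfolding f_def by (intro sum_ennreal) auto
  also have "(\<Sum>x\<in>set_mset (filter_mset (\<lambda>x. x \<in> X) R). real (count R x) / real (vert_num G)) =
      real (size (filter_mset (\<lambda>x. x \<in> X) R)) / real (vert_num G)"
    unfolding size_multiset_overloaded_eq of_nat_sum sum_divide_distrib
    by (intro sum.cong) auto
  finally show ?thesis unfolding R_def .
qed

lemma emeasure_rescaled_root_measure:
  assumes "X \<in> sets borel" and "vert_num G > 0"
  shows "emeasure (rescaled_root_measure G) X =
    emeasure (root_measure G) ((\<lambda>x. sqrt (real (vert_num G)) * x) ` X)"
proof -
  have "(\<lambda>x. x / sqrt (real (vert_num G))) -` X = (\<lambda>x. sqrt (real (vert_num G)) * x) ` X"
    using assms(2) by (force simp: image_iff field_simps)
  then show ?thesis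
    using assms(1) unfolding rescaled_root_measure_def
    by (subst emeasure_distr) (auto simp: root_measure_def)
qed

end

theory Submission
  imports Defs "HOL-Computational_Algebra.Computational_Algebra"
begin

text \<open>
  For a graph on the vertex set \<open>V\<close> let \<open>m(V, z) = (\<Sum>k. (-1)^k m_k z^k)\<close>. Deleting a vertex gives the
  continued fraction \<open>m(V - v) / m(V) = 1 / (1 - z (\<Sum>u. m(V - v - u) / m(V - v)))\<close>, the sum being over
  the neighbours \<open>u\<close> of \<open>v\<close>. Read as a statement about complex numbers, it shows inductively that the
  roots of the matching polynomial are real and at most \<open>2 sqrt n\<close> in absolute value (Heilmann--Lieb).
  Read as a statement about power series, it yields a recursion for the coefficients \<open>s_k(V, v)\<close> of
  \<open>m(V - v) / m(V)\<close>, and logarithmic differentiation identifies \<open>\<Sum>v. s_k(V, v)\<close> with the sum of the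
  \<open>2k\<close>-th powers of the roots (Godsil's closed tree-like walks).

  On the scale \<open>n^k\<close> the vertex deletions in the recursion for \<open>s_k\<close> are negligible. Without them the
  recursion counts homomorphisms from rooted plane trees with \<open>k\<close> edges, so after normalisation by
  \<open>n^(k+1)\<close> dense convergence makes every moment of the rescaled measures converge. These measures
  live on \<open>[-2, 2]\<close>, hence convergence of moments implies weak convergence.
\<close>

section \<open>Matchings on vertex subsets\<close>

text \<open>\<open>E\<close> stays fixed while \<open>V\<close> varies, so deleting a vertex only
  shrinks \<open>V\<close>; arcs with an end outside \<open>V\<close> are cut off.\<close>

definition edge_matchings :: "'a rel \<Rightarrow> 'a set \<Rightarrow> nat \<Rightarrow> 'a set set set" where
  "edge_matchings E V = matchings \<lparr>pverts = V, parcs = E \<inter> V \<times> V\<rparr>"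

lemma edge_matchings_iff:
  "M \<in> edge_matchings E V k \<longleftrightarrow>
     (\<forall>e\<in>M. \<exists>u w. e = {u, w} \<and> (u, w) \<in> E \<and> u \<in> V \<and> w \<in> V) \<and> pairwise disjnt M \<and> card M = k"
  unfolding edge_matchings_def matchings_def undirected_edges_def by auto

lemma edge_matchings_Union_subset:
  assumes "M \<in> edge_matchings E V k"
  shows "\<Union>M \<subseteq> V"
proof (rule Union_least)
  fix e assume "e \<in> M"
  then obtain u w where "e = {u, w}" "u \<in> V" "w \<in> V"
    using assms unfolding edge_matchings_iff by blast
  then show "e \<subseteq> V" by simp
qed

lemma finite_edge_matchings:
  assumes "finite V"
  shows "finite (edge_matchings E V k)"
proof (rule finite_subset)
  show "edge_matchings E V k \<subseteq> Pow (Pow V)"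
    using edge_matchings_Union_subset by blast
qed (use assms in simp)

lemma finite_edge_matching: "finite V \<Longrightarrow> M \<in> edge_matchings E V k \<Longrightarrow> finite M"
  by (meson edge_matchings_Union_subset finite_UnionD finite_subset)

lemma card_Union_edge_matching:
  assumes "irrefl E" "M \<in> edge_matchings E V k"
  shows "card (\<Union>M) = 2 * k"
proof -
  have two: "card e = 2" if "e \<in> M" for e
  proof -
    obtain u w where "e = {u, w}" "(u, w) \<in> E"
      using assms(2) \<open>e \<in> M\<close> unfolding edge_matchings_iff by blast
    then show ?thesis using assms(1) by (cases "u = w") (auto simp: irrefl_def)
  qed
  have "card (\<Union>M) = sum card M"
    using assms two by (intro card_Union_disjoint)
      (auto simp: edge_matchings_iff intro: card_ge_0_finite)
  also have "\<dots> = 2 * k"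
    using two assms by (simp add: edge_matchings_iff)
  finally show ?thesis .
qed

lemma edge_matchings_delete_vertex:
  "edge_matchings E (V - {v}) k = {M \<in> edge_matchings E V k. v \<notin> \<Union>M}"
proof (intro equalityI subsetI)
  fix M assume "M \<in> edge_matchings E (V - {v}) k"
  then show "M \<in> {M \<in> edge_matchings E V k. v \<notin> \<Union>M}"
    using edge_matchings_Union_subset[of M E "V - {v}" k] unfolding edge_matchings_iff by blast
next
  fix M assume "M \<in> {M \<in> edge_matchings E V k. v \<notin> \<Union>M}"
  then show "M \<in> edge_matchings E (V - {v}) k"
    unfolding edge_matchings_iff by (auto 0 4)
qed

text \<open>A matching covering \<open>v\<close> has exactly one edge \<open>{v, u}\<close> there;
  removing it leaves a matching that avoids both ends, and every such matching arises this
  way.\<close>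

lemma edge_matchings_through_vertex:
  assumes "finite V" "sym E" "irrefl E" "v \<in> V"
  shows "{M \<in> edge_matchings E V (Suc k). v \<in> \<Union>M} =
    (\<Union>u\<in>{u\<in>V. (v, u) \<in> E}. insert {v, u} ` edge_matchings E (V - {v} - {u}) k)"
proof (intro equalityI subsetI)
  fix M assume "M \<in> {M \<in> edge_matchings E V (Suc k). v \<in> \<Union>M}"
  then have M: "M \<in> edge_matchings E V (Suc k)" and "v \<in> \<Union>M" by auto
  then obtain e where e: "e \<in> M" "v \<in> e" by blast
  obtain a b where ab: "e = {a, b}" "(a, b) \<in> E" "a \<in> V" "b \<in> V"
    using M e(1) unfolding edge_matchings_iff by blast
  \<comment> \<open>The arc behind \<open>e\<close> may point either way: \<open>u\<close> is the
    end other than \<open>v\<close>, and symmetry supplies the arc from \<open>v\<close>.\<close>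
  define u where "u = (if v = a then b else a)"
  have u: "e = {v, u}" "(v, u) \<in> E" "u \<in> V"
    using e(2) ab symD[OF \<open>sym E\<close> ab(2)] by (auto simp: u_def)
  have "finite M" using finite_edge_matching[OF assms(1) M] .
  have "M - {e} \<in> edge_matchings E V k"
    using M e \<open>finite M\<close> unfolding edge_matchings_iff by (auto intro: pairwise_mono)
  moreover have "f \<inter> e = {}" if "f \<in> M - {e}" for f
    using M e(1) that unfolding edge_matchings_iff pairwise_def disjnt_def by auto
  then have "v \<notin> \<Union>(M - {e})" "u \<notin> \<Union>(M - {e})"
    using u(1) by auto
  ultimately have "M - {e} \<in> edge_matchings E (V - {v} - {u}) k"
    by (simp add: edge_matchings_delete_vertex)
  moreover have "M = insert {v, u} (M - {e})" using e u by auto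
  ultimately show "M \<in> (\<Union>u\<in>{u\<in>V. (v, u) \<in> E}. insert {v, u} ` edge_matchings E (V - {v} - {u}) k)"
    using u by blast
next
  fix M assume "M \<in> (\<Union>u\<in>{u\<in>V. (v, u) \<in> E}. insert {v, u} ` edge_matchings E (V - {v} - {u}) k)"
  then obtain u M' where u: "u \<in> V" "(v, u) \<in> E" and M': "M' \<in> edge_matchings E (V - {v} - {u}) k"
    and M: "M = insert {v, u} M'" by blast
  have M'': "M' \<in> edge_matchings E V k" "v \<notin> \<Union>M'" "u \<notin> \<Union>M'"
    using M' by (auto simp: edge_matchings_delete_vertex)
  then have "{v, u} \<notin> M'" "finite M'" using finite_edge_matching[OF assms(1)] by auto
  moreover have "pairwise disjnt M"
    using M'' unfolding M edge_matchings_iff pairwise_insert disjnt_def by auto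
  moreover have "\<exists>a b. e = {a, b} \<and> (a, b) \<in> E \<and> a \<in> V \<and> b \<in> V" if "e \<in> M" for e
    using that M''(1) u \<open>v \<in> V\<close> unfolding M edge_matchings_iff by (metis insert_iff)
  ultimately have "M \<in> edge_matchings E V (Suc k)"
    using M''(1) unfolding M edge_matchings_iff by simp
  then show "M \<in> {M \<in> edge_matchings E V (Suc k). v \<in> \<Union>M}"
    by (simp add: M)
qed

lemma card_edge_matchings_Suc:
  assumes "finite V" "sym E" "irrefl E" "v \<in> V"
  shows "card (edge_matchings E V (Suc k)) = card (edge_matchings E (V - {v}) (Suc k)) +
    (\<Sum>u\<in>{u\<in>V. (v, u) \<in> E}. card (edge_matchings E (V - {v} - {u}) k))"
proof -
  let ?N = "{u\<in>V. (v, u) \<in> E}"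
  let ?A = "\<lambda>u. edge_matchings E (V - {v} - {u}) k"
  have v_notin: "v \<notin> \<Union>M" if "M \<in> ?A u" for M u
    using that by (auto simp: edge_matchings_delete_vertex)
  \<comment> \<open>The edge at \<open>v\<close> reveals its partner, so the images for different
    partners are disjoint.\<close>
  have edge_in: "{v, w} \<in> insert {v, u} M \<longleftrightarrow> w = u" if "M \<in> ?A u" for M u w
    using v_notin[OF that] by (auto simp: doubleton_eq_iff)
  have inj: "inj_on (insert {v, u}) (?A u)" for u
    using v_notin by (intro inj_onI) (metis Union_iff insertI1 insert_ident)
  have disj: "insert {v, u} ` ?A u \<inter> insert {v, w} ` ?A w = {}" if "u \<noteq> w" for u w
    using edge_in that by (auto; metis insertI1)
  have "edge_matchings E V (Suc k) = edge_matchings E (V - {v}) (Suc k) \<union>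
      {M \<in> edge_matchings E V (Suc k). v \<in> \<Union>M}"
    unfolding edge_matchings_delete_vertex by blast
  also have "card \<dots> = card (edge_matchings E (V - {v}) (Suc k)) +
      card {M \<in> edge_matchings E V (Suc k). v \<in> \<Union>M}"
    by (rule card_Un_disjoint)
      (use assms(1) in \<open>auto simp: finite_edge_matchings edge_matchings_delete_vertex\<close>)
  also have "card {M \<in> edge_matchings E V (Suc k). v \<in> \<Union>M} =
      (\<Sum>u\<in>?N. card (insert {v, u} ` ?A u))"
    unfolding edge_matchings_through_vertex[OF assms]
    by (rule card_UN_disjoint) (use assms(1) disj in \<open>auto simp: finite_edge_matchings\<close>)
  also have "\<dots> = (\<Sum>u\<in>?N. card (?A u))"
    using inj by (simp add: card_image)
  finally show ?thesis .
qed

lemma edge_matchings_0 [simp]: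
  assumes "finite V"
  shows "edge_matchings E V 0 = {{}}"
proof -
  have "M = {}" if "M \<in> edge_matchings E V 0" for M
    using that finite_edge_matching[OF assms that] by (simp add: edge_matchings_iff)
  moreover have "{} \<in> edge_matchings E V 0" by (simp add: edge_matchings_iff)
  ultimately show ?thesis by blast
qed

lemma edge_matchings_eq_empty:
  assumes "finite V" "irrefl E" "card V < 2 * k"
  shows "edge_matchings E V k = {}"
proof -
  have False if M: "M \<in> edge_matchings E V k" for M
    using card_Union_edge_matching[OF assms(2) M] edge_matchings_Union_subset[OF M] assms
    by (metis card_mono not_less)
  then show ?thesis by blast
qed

text \<open>Double counting of the pairs \<open>(v, M)\<close> with \<open>v\<close> not covered by
  \<open>M\<close>. On the level of generating functions this becomes a derivative.\<close>

lemma sum_card_edge_matchings_delete: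
  assumes "finite V" "irrefl E"
  shows "(\<Sum>v\<in>V. card (edge_matchings E (V - {v}) k)) = (card V - 2 * k) * card (edge_matchings E V k)"
proof -
  have count: "card {x\<in>A. P x} = (\<Sum>x\<in>A. if P x then 1 else 0)"
    if "finite A" for A :: "'c set" and P
    by (simp add: sum.inter_filter[OF that, symmetric])
  have "(\<Sum>v\<in>V. card (edge_matchings E (V - {v}) k)) =
      (\<Sum>v\<in>V. \<Sum>M\<in>edge_matchings E V k. if v \<notin> \<Union>M then 1 else 0)"
    unfolding edge_matchings_delete_vertex
    by (rule sum.cong[OF refl], rule count, rule finite_edge_matchings[OF assms(1)])
  also have "\<dots> = (\<Sum>M\<in>edge_matchings E V k. \<Sum>v\<in>V. if v \<notin> \<Union>M then 1 else 0)"
    by (rule sum.swap)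
  also have "\<dots> = (\<Sum>M\<in>edge_matchings E V k. card V - 2 * k)"
  proof (rule sum.cong[OF refl])
    fix M assume M: "M \<in> edge_matchings E V k"
    have "(\<Sum>v\<in>V. if v \<notin> \<Union>M then 1 else 0) = card {v\<in>V. v \<notin> \<Union>M}"
      by (rule count[OF assms(1), symmetric])
    also have "{v\<in>V. v \<notin> \<Union>M} = V - \<Union>M" by blast
    also have "card \<dots> = card V - 2 * k"
      using card_Union_edge_matching[OF assms(2) M] edge_matchings_Union_subset[OF M] assms(1)
      by (metis card_Diff_subset finite_subset)
    finally show "(\<Sum>v\<in>V. if v \<notin> \<Union>M then 1 else 0) = card V - 2 * k" .
  qed
  finally show ?thesis by (simp add: mult.commute)
qed

section \<open>The Heilmann--Lieb theorem\<close>

text \<open>For \<open>n = card V\<close>, the matching polynomial is \<open>x^n\<close> times this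
  polynomial at \<open>1/x^2\<close>. The general coefficient ring serves complex evaluation as well
  as real power series.\<close>

definition matching_gen :: "'a rel \<Rightarrow> 'a set \<Rightarrow> 'b::comm_ring_1 poly" where
  "matching_gen E V = (\<Sum>k\<le>card V. monom ((-1) ^ k * of_nat (card (edge_matchings E V k))) k)"

lemma coeff_matching_gen:
  assumes "finite V" "irrefl E"
  shows "coeff (matching_gen E V) k = (-1) ^ k * of_nat (card (edge_matchings E V k))"
proof (cases "k \<le> card V")
  case True
  then show ?thesis by (simp add: matching_gen_def coeff_sum)
next
  case False
  then have "edge_matchings E V k = {}" by (intro edge_matchings_eq_empty assms) auto
  then show ?thesis using False by (auto simp: matching_gen_def coeff_sum)
qed

lemma matching_gen_rec:
  assumes "finite V" "sym E" "irrefl E" "v \<in> V"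
  shows "matching_gen E V = matching_gen E (V - {v}) -
    pCons 0 (\<Sum>u\<in>{u\<in>V. (v, u) \<in> E}. matching_gen E (V - {v} - {u}))"
proof (rule poly_eqI)
  fix k
  show "coeff (matching_gen E V) k = coeff (matching_gen E (V - {v}) -
    pCons 0 (\<Sum>u\<in>{u\<in>V. (v, u) \<in> E}. matching_gen E (V - {v} - {u}))) k"
  proof (cases k)
    case 0
    then show ?thesis using assms by (simp add: coeff_matching_gen)
  next
    case (Suc j)
    then show ?thesis
      using assms card_edge_matchings_Suc[OF assms, of j]
      by (simp add: coeff_matching_gen coeff_sum algebra_simps sum_distrib_left sum_negf)
  qed
qed

text \<open>For \<open>v\<close> in \<open>V\<close> this is the quotient of the matching
  polynomials of \<open>V - {v}\<close> and \<open>V\<close> at \<open>x\<close>; their degrees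
  differ by one, whence the factor \<open>x\<close>.\<close>

definition matching_ratio :: "'a rel \<Rightarrow> complex \<Rightarrow> 'a set \<Rightarrow> 'a \<Rightarrow> complex" where
  "matching_ratio E x V v =
     poly (matching_gen E (V - {v})) (1 / x\<^sup>2) / (x * poly (matching_gen E V) (1 / x\<^sup>2))"

text \<open>The continued fraction multiplied out, so that nonvanishing for \<open>V\<close> can be
  deduced from it instead of being presupposed.\<close>

lemma matching_gen_ratio_rec:
  assumes "finite V" "sym E" "irrefl E" "v \<in> V" "x \<noteq> 0"
    and "poly (matching_gen E (V - {v})) (1 / x\<^sup>2) \<noteq> 0"
  shows "x * poly (matching_gen E V) (1 / x\<^sup>2) = poly (matching_gen E (V - {v})) (1 / x\<^sup>2) *
    (x - (\<Sum>u\<in>{u\<in>V. (v, u) \<in> E}. matching_ratio E x (V - {v}) u))"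
proof -
  let ?P = "\<lambda>V. poly (matching_gen E V) (1 / x\<^sup>2)"
  have "x * ?P V = x * ?P (V - {v}) - (\<Sum>u\<in>{u\<in>V. (v, u) \<in> E}. ?P (V - {v} - {u})) / x"
    using assms(5) by (subst matching_gen_rec[OF assms(1-4)])
      (simp add: poly_sum field_simps power2_eq_square)
  also have "(\<Sum>u\<in>{u\<in>V. (v, u) \<in> E}. ?P (V - {v} - {u})) / x =
      ?P (V - {v}) * (\<Sum>u\<in>{u\<in>V. (v, u) \<in> E}. matching_ratio E x (V - {v}) u)"
    unfolding sum_distrib_left sum_divide_distrib matching_ratio_def
    using assms(5,6) by (intro sum.cong refl) (simp add: field_simps)
  finally show ?thesis by (simp add: algebra_simps)
qed

text \<open>The ratios map the upper half plane to the lower one, by the continued fraction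
  \<open>ratio V v = 1 / (x - (\<Sum>u. ratio (V - {v}) u))\<close>.\<close>

lemma matching_gen_upper_half_plane:
  assumes "finite V" "sym E" "irrefl E" "Im x > 0"
  shows "poly (matching_gen E V) (1 / x\<^sup>2) \<noteq> 0 \<and> (\<forall>v\<in>V. Im (matching_ratio E x V v) < 0)"
  using assms(1)
proof (induction V rule: finite_psubset_induct)
  case (psubset V)
  let ?P = "\<lambda>V. poly (matching_gen E V) (1 / x\<^sup>2)"
  have x: "x \<noteq> 0" using assms(4) by auto
  have *: "?P V \<noteq> 0 \<and> Im (matching_ratio E x V v) < 0" if v: "v \<in> V" for v
  proof -
    define y where "y = x - (\<Sum>u\<in>{u\<in>V. (v, u) \<in> E}. matching_ratio E x (V - {v}) u)"
    have IH: "?P (V - {v}) \<noteq> 0" "\<And>u. u \<in> V - {v} \<Longrightarrow> Im (matching_ratio E x (V - {v}) u) < 0"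
      using psubset.IH[of "V - {v}"] v by auto
    \<comment> \<open>Irreflexivity places all neighbours in \<open>V - {v}\<close>, where the
      induction hypothesis applies; subtracting their ratios can only raise the imaginary part of
      \<open>x\<close>.\<close>
    have "(\<Sum>u\<in>{u\<in>V. (v, u) \<in> E}. Im (matching_ratio E x (V - {v}) u)) \<le> 0"
      by (intro sum_nonpos less_imp_le IH) (use \<open>irrefl E\<close> in \<open>auto simp: irrefl_def\<close>)
    then have y: "Im y > 0" using assms(4) by (simp add: y_def Im_sum)
    then have "y \<noteq> 0" by (metis less_irrefl zero_complex.simps(2))
    have rec: "x * ?P V = ?P (V - {v}) * y"
      unfolding y_def by (rule matching_gen_ratio_rec) (use assms v x IH psubset.hyps in auto)
    then have "?P V \<noteq> 0" using IH(1) \<open>y \<noteq> 0\<close> by auto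
    moreover have "matching_ratio E x V v = inverse y"
      unfolding matching_ratio_def rec using IH(1) \<open>y \<noteq> 0\<close> by (simp add: field_simps)
    moreover have "Im (inverse y) < 0"
      using y by (simp add: divide_neg_pos sum_power2_gt_zero_iff)
    ultimately show ?thesis by simp
  qed
  show ?case
  \<comment> \<open>Nonvanishing follows from \<open>*\<close> only if some vertex exists; for the
    empty set the polynomial is \<open>1\<close>.\<close>
  proof (cases "V = {}")
    case True
    then show ?thesis by (simp add: matching_gen_def)
  qed (use * in blast)
qed

text \<open>The bound reproduces itself: at most \<open>r^2\<close> neighbours with ratios of
  modulus at most \<open>1 / r\<close> move the denominator by at most \<open>r\<close>, so its
  modulus is at least \<open>2 * r - r\<close>. The radius \<open>r\<close> stays fixed while
  \<open>V\<close> shrinks.\<close>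

lemma matching_gen_large:
  assumes "finite V" "sym E" "irrefl E" "real (card V) \<le> r\<^sup>2" "r > 0" "cmod x \<ge> 2 * r"
  shows "poly (matching_gen E V) (1 / x\<^sup>2) \<noteq> 0 \<and> (\<forall>v\<in>V. cmod (matching_ratio E x V v) \<le> 1 / r)"
  using assms(1,4)
proof (induction V rule: finite_psubset_induct)
  case (psubset V)
  let ?P = "\<lambda>V. poly (matching_gen E V) (1 / x\<^sup>2)"
  have x: "x \<noteq> 0" using assms(5,6) by auto
  have *: "?P V \<noteq> 0 \<and> cmod (matching_ratio E x V v) \<le> 1 / r" if v: "v \<in> V" for v
  proof -
    let ?N = "{u\<in>V. (v, u) \<in> E}"
    define y where "y = x - (\<Sum>u\<in>?N. matching_ratio E x (V - {v}) u)"
    have "card (V - {v}) \<le> card V" using psubset.hyps by (simp add: card_mono)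
    then have IH: "?P (V - {v}) \<noteq> 0" "\<And>u. u \<in> V - {v} \<Longrightarrow> cmod (matching_ratio E x (V - {v}) u) \<le> 1 / r"
      using psubset.IH[of "V - {v}"] v psubset.prems \<open>card (V - {v}) \<le> card V\<close> by fastforce+
    have "cmod (\<Sum>u\<in>?N. matching_ratio E x (V - {v}) u) \<le> real (card ?N) * (1 / r)"
      by (intro sum_norm_bound IH) (use \<open>irrefl E\<close> in \<open>auto simp: irrefl_def\<close>)
    also have "\<dots> \<le> r\<^sup>2 * (1 / r)"
    proof (rule mult_right_mono)
      have "card ?N \<le> card V" using psubset.hyps by (intro card_mono) auto
      then show "real (card ?N) \<le> r\<^sup>2" using psubset.prems by linarith
    qed (use assms(5) in simp)
    also have "\<dots> = r" using assms(5) by (simp add: power2_eq_square)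
    finally have y: "cmod y \<ge> r"
      unfolding y_def
      using assms(6) norm_triangle_ineq2[of x "\<Sum>u\<in>?N. matching_ratio E x (V - {v}) u"] by linarith
    then have "y \<noteq> 0" using assms(5) by (metis norm_zero not_less)
    have rec: "x * ?P V = ?P (V - {v}) * y"
      unfolding y_def by (rule matching_gen_ratio_rec) (use assms v x IH psubset.hyps in auto)
    then have "?P V \<noteq> 0" using IH(1) \<open>y \<noteq> 0\<close> by auto
    moreover have "matching_ratio E x V v = 1 / y"
      unfolding matching_ratio_def rec using IH(1) \<open>y \<noteq> 0\<close> by (simp add: field_simps)
    moreover have "cmod (1 / y) \<le> 1 / r"
      using y assms(5) unfolding norm_divide norm_one by (intro frac_le) auto
    ultimately show ?thesis by metis
  qed
  show ?case
  proof (cases "V = {}")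
    case True
    then show ?thesis by (simp add: matching_gen_def)
  qed (use * in blast)
qed

section \<open>From zero-free regions to the real roots of the matching polynomial\<close>

lemma poly_map_poly_of_real:
  "poly (map_poly of_real p) (complex_of_real x) = complex_of_real (poly p x)"
  by (induction p) (simp_all add: map_poly_pCons)

text \<open>Split off one complex root at a time, which is real by assumption; the complex roots of
  the quotient are among those of \<open>p\<close>.\<close>

lemma real_rooted_poly_splits:
  fixes p :: "real poly"
  assumes "p \<noteq> 0" "\<And>z::complex. poly (map_poly of_real p) z = 0 \<Longrightarrow> z \<in> \<real>"
  shows "p = smult (lead_coeff p) (\<Prod>a\<in>#proots p. [:-a, 1:]) \<and> size (proots p) = degree p"
  using assms
proof (induction "degree p" arbitrary: p)
  case 0
  then obtain c where "p = [:c:]" "c \<noteq> 0" by (metis degree_eq_zeroE pCons_eq_0_iff)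
  then show ?case by simp
next
  case (Suc d)
  have "degree (map_poly of_real p :: complex poly) > 0"
    using Suc.hyps(2) by (simp add: degree_map_poly)
  from alg_closed_imp_poly_has_root[OF this]
  obtain z :: complex where z: "poly (map_poly of_real p) z = 0" ..
  then obtain a where a: "z = of_real a" using Suc.prems(2) Reals_cases by blast
  have "poly p a = 0" using z unfolding a by (simp add: poly_map_poly_of_real)
  then obtain q where q: "p = [:-a, 1:] * q" by (metis dvdE poly_eq_0_iff_dvd)
  then have "q \<noteq> 0" using Suc.prems(1) by auto
  have deg: "degree p = Suc (degree q)" unfolding q using \<open>q \<noteq> 0\<close> by (subst degree_mult_eq) auto
  have lead: "lead_coeff p = lead_coeff q" unfolding q by (subst lead_coeff_mult) simp
  have map: "(map_poly of_real p :: complex poly) = [:-of_real a, 1:] * map_poly of_real q"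
    unfolding q by (intro poly_eqI) (simp add: coeff_map_poly coeff_pCons split: nat.split)
  have IH: "q = smult (lead_coeff q) (\<Prod>a\<in>#proots q. [:-a, 1:]) \<and> size (proots q) = degree q"
    using Suc.hyps(2) deg \<open>q \<noteq> 0\<close> Suc.prems(2) map by (intro Suc.hyps) auto
  have roots: "proots p = add_mset a (proots q)"
    unfolding q using \<open>q \<noteq> 0\<close> by (subst proots_mult) auto
  have "p = smult (lead_coeff q) ([:-a, 1:] * (\<Prod>a\<in>#proots q. [:-a, 1:]))"
    by (subst q, subst conjunct1[OF IH]) (simp only: mult_smult_right)
  then have "p = smult (lead_coeff p) (\<Prod>a\<in>#proots p. [:-a, 1:])"
    unfolding lead roots image_mset_add_mset prod_mset.add_mset .
  moreover have "size (proots p) = degree p"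
    using conjunct2[OF IH] by (simp only: deg roots size_add_mset)
  ultimately show ?case ..
qed

text \<open>Counterpart of \<open>matching_poly\<close> over an arbitrary coefficient ring, so that
  it can be evaluated at complex points.\<close>

definition matching_poly_on :: "'a rel \<Rightarrow> 'a set \<Rightarrow> 'b::comm_ring_1 poly" where
  "matching_poly_on E V = (\<Sum>k = 0..card V div 2.
     monom ((-1) ^ k * of_nat (card (edge_matchings E V k))) (card V - 2 * k))"

lemma map_poly_matching_poly_on:
  "map_poly of_real (matching_poly_on E V) = (matching_poly_on E V :: complex poly)"
  unfolding matching_poly_on_def
  by (intro poly_eqI) (simp add: coeff_map_poly coeff_sum if_distrib cong: if_cong)

lemma poly_matching_poly_on:
  fixes x :: "'b::field"
  assumes "finite V" "irrefl E" "x \<noteq> 0"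
  shows "poly (matching_poly_on E V) x = x ^ card V * poly (matching_gen E V) (1 / x\<^sup>2)"
proof -
  have "poly (matching_gen E V) (1 / x\<^sup>2) =
      (\<Sum>k\<le>card V. (-1) ^ k * of_nat (card (edge_matchings E V k)) * (1 / x\<^sup>2) ^ k)"
    by (simp add: matching_gen_def poly_sum poly_monom)
  also have "\<dots> = (\<Sum>k\<in>{0..card V div 2}. (-1) ^ k * of_nat (card (edge_matchings E V k)) * (1 / x\<^sup>2) ^ k)"
    using assms by (intro sum.mono_neutral_right) (auto simp: edge_matchings_eq_empty)
  finally have "x ^ card V * poly (matching_gen E V) (1 / x\<^sup>2) =
      (\<Sum>k\<in>{0..card V div 2}. (-1) ^ k * of_nat (card (edge_matchings E V k)) * (x ^ card V * (1 / x\<^sup>2) ^ k))"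
    by (simp add: sum_distrib_left mult_ac)
  also have "\<dots> = poly (matching_poly_on E V) x"
    unfolding matching_poly_on_def poly_sum poly_monom
  proof (intro sum.cong refl)
    fix k assume "k \<in> {0..card V div 2}"
    then have "card V = (card V - 2 * k) + 2 * k" by auto
    then have "x ^ card V = x ^ (card V - 2 * k) * (x\<^sup>2) ^ k"
      by (metis power_add power_mult)
    then have "x ^ card V * (1 / x\<^sup>2) ^ k = x ^ (card V - 2 * k)"
      using assms(3) by (simp add: power_divide)
    then show "(-1) ^ k * of_nat (card (edge_matchings E V k)) * (x ^ card V * (1 / x\<^sup>2) ^ k) =
        (-1) ^ k * of_nat (card (edge_matchings E V k)) * x ^ (card V - 2 * k)" by simp
  qed
  finally show ?thesis ..
qed

text \<open>Coefficients counted from the top describe the reflected polynomial, which is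
  \<open>matching_gen\<close> in the squared variable.\<close>

lemma coeff_matching_poly_on:
  assumes "finite V" "irrefl E" "j \<le> card V"
  shows "coeff (matching_poly_on E V) (card V - j) =
    (if even j then (-1) ^ (j div 2) * of_nat (card (edge_matchings E V (j div 2))) else 0)"
proof -
  \<comment> \<open>The bounds on \<open>k\<close> and \<open>j\<close> ensure that truncated
    subtraction loses nothing.\<close>
  have eq: "card V - 2 * k = card V - j \<longleftrightarrow> 2 * k = j" if "k \<in> {0..card V div 2}" for k
    using that assms(3) by auto
  have "coeff (matching_poly_on E V) (card V - j) = (\<Sum>k = 0..card V div 2.
     if 2 * k = j then (-1) ^ k * of_nat (card (edge_matchings E V k)) else 0)"
    unfolding matching_poly_on_def coeff_sum coeff_monom by (intro sum.cong refl) (simp add: eq)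
  also have "\<dots> = (if even j then (-1) ^ (j div 2) * of_nat (card (edge_matchings E V (j div 2))) else 0)"
  proof (cases "even j")
    case True
    then have "(2 * k = j) = (k = j div 2)" for k by auto
    then show ?thesis using True assms(3) by (simp add: div_le_mono)
  next
    case False
    then have "2 * k \<noteq> j" for k by auto
    then show ?thesis using False by simp
  qed
  finally show ?thesis .
qed

lemma matching_poly_on_degree:
  assumes "finite V" "irrefl E"
  shows "degree (matching_poly_on E V :: 'b::comm_ring_1 poly) = card V"
    and "lead_coeff (matching_poly_on E V :: 'b::comm_ring_1 poly) = 1"
proof -
  have lead: "coeff (matching_poly_on E V) (card V) = (1 :: 'b)"
    using coeff_matching_poly_on[OF assms, of 0] assms by simp
  have "degree (matching_poly_on E V :: 'b poly) \<le> card V"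
    unfolding matching_poly_on_def by (intro degree_sum_le order_trans[OF degree_monom_le]) auto
  then show deg: "degree (matching_poly_on E V :: 'b poly) = card V"
    using lead by (intro antisym le_degree) auto
  show "lead_coeff (matching_poly_on E V :: 'b poly) = 1"
    using lead deg by simp
qed

lemma matching_poly_on_splits:
  assumes "finite V" "sym E" "irrefl E"
  defines "R \<equiv> proots (matching_poly_on E V :: real poly)"
  shows "matching_poly_on E V = (\<Prod>a\<in>#R. [:-a, 1:])" "size R = card V"
proof -
  let ?p = "matching_poly_on E V :: real poly"
  have "z \<in> \<real>" if z: "poly (map_poly of_real ?p) z = 0" for z :: complex
  proof (rule ccontr)
    assume "z \<notin> \<real>"
    then have "z \<noteq> 0" "Im z \<noteq> 0" by (auto simp: complex_is_Real_iff)
    \<comment> \<open>Only the square of \<open>z\<close> enters, so the sign may be chosen to land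
      in the upper half plane.\<close>
    define x where "x = (if Im z > 0 then z else -z)"
    have "Im x > 0" using \<open>Im z \<noteq> 0\<close> by (auto simp: x_def)
    then have "poly (matching_gen E V) (1 / x\<^sup>2) \<noteq> 0"
      using matching_gen_upper_half_plane[OF assms(1-3)] by blast
    also have "x\<^sup>2 = z\<^sup>2" by (simp add: x_def)
    finally show False
      using z \<open>z \<noteq> 0\<close> assms by (simp add: map_poly_matching_poly_on poly_matching_poly_on)
  qed
  moreover have "?p \<noteq> 0"
    using matching_poly_on_degree(2)[OF assms(1,3), where ?'b = real] by auto
  ultimately have *: "?p = smult (lead_coeff ?p) (\<Prod>a\<in>#proots ?p. [:-a, 1:]) \<and> size (proots ?p) = degree ?p"
    by (intro real_rooted_poly_splits)
  then show "matching_poly_on E V = (\<Prod>a\<in>#R. [:-a, 1:])"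
    using matching_poly_on_degree(2)[OF assms(1,3), where ?'b = real] by (simp add: R_def)
  show "size R = card V"
    using * matching_poly_on_degree(1)[OF assms(1,3), where ?'b = real] by (simp add: R_def)
qed

lemma abs_root_matching_poly_on_le:
  fixes a :: real
  assumes "finite V" "sym E" "irrefl E" "poly (matching_poly_on E V) a = 0"
  shows "\<bar>a\<bar> \<le> 2 * sqrt (real (card V))"
proof (rule ccontr)
  assume "\<not> ?thesis"
  then have a: "\<bar>a\<bar> > 2 * sqrt (real (card V))" by simp
  \<comment> \<open>The empty graph has the constant polynomial \<open>1\<close>, so a root forces a
    vertex and hence a positive radius \<open>sqrt (card V)\<close>.\<close>
  have "V \<noteq> {}" using assms(4) by (auto simp: matching_poly_on_def)
  then have "card V > 0" using assms(1) by (simp add: card_gt_0_iff)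
  moreover have "a \<noteq> 0" using a by auto
  ultimately have "poly (matching_gen E V) (1 / (complex_of_real a)\<^sup>2) \<noteq> 0"
    using matching_gen_large[OF assms(1-3), of "sqrt (card V)" "complex_of_real a"] a by simp
  then have "poly (matching_poly_on E V) (complex_of_real a) \<noteq> 0"
    using assms \<open>a \<noteq> 0\<close> by (simp add: poly_matching_poly_on)
  also have "poly (matching_poly_on E V) (complex_of_real a) = complex_of_real (poly (matching_poly_on E V) a)"
    by (simp add: poly_map_poly_of_real flip: map_poly_matching_poly_on)
  finally show False using assms(4) by simp
qed

section \<open>Power sums of the roots\<close>

unbundle no vec_syntax

text \<open>The number of closed walks of length \<open>2k\<close> starting at the root of Godsil's path tree of \<open>(V, v)\<close>.\<close>

fun treelike_walks :: "'a rel \<Rightarrow> nat \<Rightarrow> 'a set \<Rightarrow> 'a \<Rightarrow> real" where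
  "treelike_walks E 0 V v = 1"
| "treelike_walks E (Suc k) V v = (\<Sum>i\<le>k. treelike_walks E i V v *
     (\<Sum>u\<in>{u\<in>V. (v, u) \<in> E}. treelike_walks E (k - i) (V - {v}) u))"

text \<open>The recursion of the walks says \<open>T = 1 + X * T * S\<close>, where \<open>S\<close>
  sums the series of the neighbours in \<open>V - {v}\<close>. Thus
  \<open>T = 1 / (1 - X * S)\<close>, the continued fraction of the matching quotient.\<close>

lemma treelike_walks_fps:
  fixes V :: "'a set"
  assumes "finite V" "sym E" "irrefl E" "v \<in> V"
  shows "Abs_fps (\<lambda>k. treelike_walks E k V v) * fps_of_poly (matching_gen E V) =
    fps_of_poly (matching_gen E (V - {v}))"
  using assms(1,4)
proof (induction V arbitrary: v rule: finite_psubset_induct)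
  case (psubset V)
  define T where "T = (\<lambda>V v. Abs_fps (\<lambda>k. treelike_walks E k V v))"
  let ?G = "\<lambda>V. fps_of_poly (matching_gen E V) :: real fps"
  let ?N = "{u\<in>V. (v, u) \<in> E}"
  have T: "T V v = 1 + fps_X * (T V v * (\<Sum>u\<in>?N. T (V - {v}) u))"
  proof (rule fps_ext)
    fix k show "T V v $ k = (1 + fps_X * (T V v * (\<Sum>u\<in>?N. T (V - {v}) u))) $ k"
    proof (cases k)
      case (Suc j)
      have "(T V v * (\<Sum>u\<in>?N. T (V - {v}) u)) $ j = treelike_walks E (Suc j) V v"
        by (simp add: T_def fps_mult_nth fps_sum_nth atLeast0AtMost)
      then show ?thesis using Suc by (simp add: T_def)
    qed (simp add: T_def)
  qed
  have "?G V = ?G (V - {v}) - fps_X * (\<Sum>u\<in>?N. ?G (V - {v} - {u}))"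
    by (subst matching_gen_rec[OF psubset.hyps assms(2,3) psubset.prems])
      (simp add: fps_of_poly_diff fps_of_poly_pCons fps_of_poly_sum mult.commute)
  \<comment> \<open>The induction hypothesis for \<open>V - {v}\<close> factors
    \<open>?G (V - {v})\<close> out of every summand.\<close>
  also have "(\<Sum>u\<in>?N. ?G (V - {v} - {u})) = (\<Sum>u\<in>?N. T (V - {v}) u) * ?G (V - {v})"
    unfolding sum_distrib_right T_def
    using psubset.prems assms(3) by (intro sum.cong refl psubset.IH[symmetric]) (auto simp: irrefl_def)
  finally have G: "?G V = (1 - fps_X * (\<Sum>u\<in>?N. T (V - {v}) u)) * ?G (V - {v})"
    by (simp add: algebra_simps)
  have "T V v * (1 - fps_X * (\<Sum>u\<in>?N. T (V - {v}) u)) = 1"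
    using T by (simp add: algebra_simps)
  then have "T V v * ?G V = ?G (V - {v})"
    by (subst G, subst mult.assoc[symmetric]) simp
  then show ?case by (simp add: T_def)
qed

text \<open>Sum the quotients \<open>m(V - v) / m(V)\<close> over \<open>v\<close>: by double
  counting the numerators add up to \<open>n * m - 2 * X * m'\<close>.\<close>

lemma sum_treelike_walks_fps:
  fixes V :: "'a set"
  assumes "finite V" "sym E" "irrefl E"
  defines "G \<equiv> fps_of_poly (matching_gen E V) :: real fps"
  shows "Abs_fps (\<lambda>k. \<Sum>v\<in>V. treelike_walks E k V v) * G = of_nat (card V) * G - 2 * fps_X * fps_deriv G"
proof -
  have "Abs_fps (\<lambda>k. \<Sum>v\<in>V. treelike_walks E k V v) = (\<Sum>v\<in>V. Abs_fps (\<lambda>k. treelike_walks E k V v))"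
    by (rule fps_ext) (simp add: fps_sum_nth)
  then have "Abs_fps (\<lambda>k. \<Sum>v\<in>V. treelike_walks E k V v) * G =
      (\<Sum>v\<in>V. fps_of_poly (matching_gen E (V - {v})))"
    by (simp add: sum_distrib_right G_def treelike_walks_fps[OF assms(1-3)])
  also have "\<dots> = of_nat (card V) * G - 2 * fps_X * fps_deriv G"
  proof (rule fps_ext)
    fix k
    have "(\<Sum>v\<in>V. fps_of_poly (matching_gen E (V - {v}))) $ k =
        (-1) ^ k * real (\<Sum>v\<in>V. card (edge_matchings E (V - {v}) k))"
      using assms by (simp add: fps_sum_nth coeff_matching_gen sum_distrib_left)
    also have "\<dots> = (-1) ^ k * ((real (card V) - 2 * real k) * real (card (edge_matchings E V k)))"
    proof (cases "2 * k \<le> card V")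
      \<comment> \<open>Truncated and real subtraction may differ here, but both sides vanish since
        no matching has \<open>k\<close> edges.\<close>
      case False
      then show ?thesis using assms
        by (simp add: sum_card_edge_matchings_delete edge_matchings_eq_empty del: of_nat_sum)
    qed (use assms in \<open>simp add: sum_card_edge_matchings_delete of_nat_diff del: of_nat_sum\<close>)
    also have "\<dots> = (of_nat (card V) * G - 2 * fps_X * fps_deriv G) $ k"
      using assms(1-3) by (cases k)
        (simp_all add: G_def coeff_matching_gen algebra_simps fps_of_nat[symmetric] numeral_fps_const)
    finally show "(\<Sum>v\<in>V. fps_of_poly (matching_gen E (V - {v}))) $ k =
      (of_nat (card V) * G - 2 * fps_X * fps_deriv G) $ k" .
  qed
  finally show ?thesis .
qed

section \<open>Newton's identities as power series\<close>

lemma geometric_fps: "(1 - fps_const a * fps_X) * Abs_fps (\<lambda>j. a ^ j) = (1 :: 'b::comm_ring_1 fps)"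
proof (rule fps_ext)
  fix n show "((1 - fps_const a * fps_X) * Abs_fps (\<lambda>j. a ^ j)) $ n = (1 :: 'b fps) $ n"
    by (cases n) (simp_all add: left_diff_distrib mult.assoc)
qed

text \<open>Logarithmic differentiation: \<open>X * A' / A\<close> is the sum of
  \<open>- a * X / (1 - a * X) = 1 - 1 / (1 - a * X)\<close>, and \<open>1 / (1 - a * X)\<close>
  generates the powers of \<open>a\<close>. The induction proves this without dividing.\<close>

lemma power_sums_fps:
  fixes R :: "'b::comm_ring_1 multiset"
  defines "A \<equiv> \<Prod>a\<in>#R. 1 - fps_const a * fps_X"
  shows "A * Abs_fps (\<lambda>j. \<Sum>a\<in>#R. a ^ j) = of_nat (size R) * A - fps_X * fps_deriv A"
  unfolding A_def
proof (induction R)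
  case empty
  then show ?case by (simp add: fps_eq_iff)
next
  case (add a R)
  let ?A = "\<Prod>a\<in>#R. 1 - fps_const a * fps_X" and ?S = "Abs_fps (\<lambda>j. \<Sum>a\<in>#R. a ^ j)"
  have "Abs_fps (\<lambda>j. \<Sum>a\<in>#add_mset a R. a ^ j) = Abs_fps (\<lambda>j. a ^ j) + ?S"
    by (rule fps_ext) simp
  then have "(\<Prod>a\<in>#add_mset a R. 1 - fps_const a * fps_X) * Abs_fps (\<lambda>j. \<Sum>a\<in>#add_mset a R. a ^ j) =
      ((1 - fps_const a * fps_X) * Abs_fps (\<lambda>j. a ^ j)) * ?A + (1 - fps_const a * fps_X) * (?A * ?S)"
    by (simp add: algebra_simps)
  also have "\<dots> = ?A + (1 - fps_const a * fps_X) * (of_nat (size R) * ?A - fps_X * fps_deriv ?A)"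
    by (simp only: geometric_fps add.IH mult_1_left)
  also have "\<dots> = of_nat (size (add_mset a R)) * (\<Prod>a\<in>#add_mset a R. 1 - fps_const a * fps_X) -
      fps_X * fps_deriv (\<Prod>a\<in>#add_mset a R. 1 - fps_const a * fps_X)"
    by (simp add: algebra_simps)
  finally show ?case .
qed

lemma reflect_poly_prod_linear_fps:
  fixes R :: "'b::field multiset"
  shows "fps_of_poly (reflect_poly (\<Prod>a\<in>#R. [:-a, 1:])) = (\<Prod>a\<in>#R. 1 - fps_const a * fps_X)"
proof (induction R)
  case (add a R)
  have "reflect_poly [:-a, 1:] = [:1, -a:]"
    by (intro poly_eqI) (auto simp: coeff_reflect_poly coeff_pCons split: nat.splits)
  then have "fps_of_poly (reflect_poly [:-a, 1:]) = 1 - fps_const a * fps_X"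
    by (simp add: fps_of_poly_linear' flip: fps_const_neg)
  then show ?case using add.IH
    unfolding image_mset_add_mset prod_mset.add_mset reflect_poly_mult fps_of_poly_mult by (simp only:)
qed simp

text \<open>The reflected matching polynomial is \<open>A = G(X^2)\<close>. The series of the power
  sums and the series \<open>S(X^2)\<close> of the walks both equal \<open>n - X * A' / A\<close>,
  hence each other; only even exponents occur in the latter.\<close>

lemma power_sum_roots_matching_poly_on:
  fixes V :: "'a set"
  assumes "finite V" "sym E" "irrefl E"
  shows "(\<Sum>a\<in>#proots (matching_poly_on E V). a ^ j) =
    (if even j then \<Sum>v\<in>V. treelike_walks E (j div 2) V v else 0)"
proof -
  define R where "R = proots (matching_poly_on E V :: real poly)"
  define G where "G = (fps_of_poly (matching_gen E V) :: real fps)"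
  define A where "A = G oo fps_X ^ 2"
  define S where "S = Abs_fps (\<lambda>k. \<Sum>v\<in>V. treelike_walks E k V v)"
  note split = matching_poly_on_splits[OF assms, folded R_def]
  have A_prod: "A = (\<Prod>a\<in>#R. 1 - fps_const a * fps_X)"
    unfolding reflect_poly_prod_linear_fps[symmetric] split(1)[symmetric]
  proof (rule fps_ext)
    fix j
    show "A $ j = fps_of_poly (reflect_poly (matching_poly_on E V)) $ j"
      using assms coeff_matching_poly_on[OF assms(1,3), of j, where ?'b = real]
        edge_matchings_eq_empty[OF assms(1,3), of "j div 2"]
      by (auto simp: A_def G_def fps_nth_compose_X_power coeff_reflect_poly matching_poly_on_degree
          coeff_matching_gen not_less)
  qed
  have "A * Abs_fps (\<lambda>j. \<Sum>a\<in>#R. a ^ j) = of_nat (card V) * A - fps_X * fps_deriv A"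
    using power_sums_fps[of R] split(2) by (simp only: A_prod)
  \<comment> \<open>Chain rule; the result is \<open>2 * X * G'\<close> with \<open>X^2\<close>
    substituted for \<open>X\<close>.\<close>
  also have "fps_X * fps_deriv A = 2 * fps_X ^ 2 * (fps_deriv G oo fps_X ^ 2)"
    unfolding A_def by (subst fps_compose_deriv) (simp_all add: fps_deriv_power power2_eq_square)
  also have "of_nat (card V) * A - 2 * fps_X ^ 2 * (fps_deriv G oo fps_X ^ 2) =
      (of_nat (card V) * G - 2 * fps_X * fps_deriv G) oo fps_X ^ 2"
    unfolding A_def by (simp add: fps_compose_sub_distrib fps_compose_mult_distrib fps_of_nat[symmetric])
  also have "\<dots> = (S oo fps_X ^ 2) * A"
    unfolding sum_treelike_walks_fps[OF assms, folded G_def S_def, symmetric] A_def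
    by (simp add: fps_compose_mult_distrib)
  finally have "A * Abs_fps (\<lambda>j. \<Sum>a\<in>#R. a ^ j) = A * (S oo fps_X ^ 2)"
    by (simp add: mult.commute)
  \<comment> \<open>The constant coefficient makes \<open>A\<close> nonzero and hence
    cancellable.\<close>
  moreover have "A $ 0 = 1"
    using assms by (simp add: A_def G_def coeff_matching_gen)
  then have "A \<noteq> 0" by auto
  ultimately have "Abs_fps (\<lambda>j. \<Sum>a\<in>#R. a ^ j) = S oo fps_X ^ 2" by simp
  then have "Abs_fps (\<lambda>j. \<Sum>a\<in>#R. a ^ j) $ j = (S oo fps_X ^ 2) $ j" by (rule arg_cong)
  then show ?thesis by (simp add: fps_nth_compose_X_power R_def S_def)
qed

section \<open>Neglecting the vertex deletions\<close>

text \<open>The number of homomorphisms from rooted plane trees with \<open>k\<close> edges that send the root to \<open>v\<close>.\<close>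

fun tree_homs :: "'a rel \<Rightarrow> 'a set \<Rightarrow> nat \<Rightarrow> 'a \<Rightarrow> real" where
  "tree_homs E V 0 v = 1"
| "tree_homs E V (Suc k) v = (\<Sum>i\<le>k. tree_homs E V i v *
     (\<Sum>u\<in>{u\<in>V. (v, u) \<in> E}. tree_homs E V (k - i) u))"

text \<open>The Catalan numbers, which count the rooted plane trees with \<open>k\<close>
  edges.\<close>

fun catalan_real :: "nat \<Rightarrow> real" where
  "catalan_real 0 = 1"
| "catalan_real (Suc k) = (\<Sum>i\<le>k. catalan_real i * catalan_real (k - i))"

text \<open>Constants that close the induction in \<open>tree_homs_minus_treelike_walks\<close>. The
  summands account for the error of the first factor, for the neighbours lost to deletions, and for
  the error at the remaining neighbours.\<close>

fun walk_error :: "nat \<Rightarrow> real" where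
  "walk_error 0 = 0"
| "walk_error (Suc k) = (\<Sum>i\<le>k. walk_error i * catalan_real (k - i) +
     catalan_real i * (catalan_real (k - i) + 2 * walk_error (k - i)))"

lemma catalan_real_nonneg: "catalan_real k \<ge> 0"
  by (induction k rule: less_induct) (case_tac x; auto intro!: sum_nonneg)

lemma walk_error_nonneg: "walk_error k \<ge> 0"
proof (induction k rule: less_induct)
  case (less k)
  then show ?case
    by (cases k) (auto intro!: sum_nonneg add_nonneg_nonneg mult_nonneg_nonneg simp: catalan_real_nonneg)
qed

lemma tree_homs_nonneg: "tree_homs E V k v \<ge> 0"
proof (induction k arbitrary: v rule: less_induct)
  case (less k)
  then show ?case by (cases k) (auto intro!: sum_nonneg mult_nonneg_nonneg)
qed

lemma treelike_walks_nonneg: "treelike_walks E k V v \<ge> 0"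
proof (induction k arbitrary: V v rule: less_induct)
  case (less k)
  then show ?case by (cases k) (auto intro!: sum_nonneg mult_nonneg_nonneg)
qed

text \<open>Deletions only remove nonnegative terms. The set \<open>W\<close> is general because the
  recursion shrinks it.\<close>

lemma treelike_walks_le_tree_homs:
  assumes "finite V" "W \<subseteq> V"
  shows "treelike_walks E k W v \<le> tree_homs E V k v"
  using assms(2)
proof (induction k arbitrary: W v rule: less_induct)
  case (less k)
  show ?case
  proof (cases k)
    case (Suc j)
    have "(\<Sum>u\<in>{u\<in>W. (v, u) \<in> E}. treelike_walks E (j - i) (W - {v}) u) \<le>
        (\<Sum>u\<in>{u\<in>V. (v, u) \<in> E}. tree_homs E V (j - i) u)" for i
    proof -
      have "(\<Sum>u\<in>{u\<in>W. (v, u) \<in> E}. treelike_walks E (j - i) (W - {v}) u) \<le>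
          (\<Sum>u\<in>{u\<in>W. (v, u) \<in> E}. tree_homs E V (j - i) u)"
        using less Suc by (intro sum_mono less.IH) auto
      also have "\<dots> \<le> (\<Sum>u\<in>{u\<in>V. (v, u) \<in> E}. tree_homs E V (j - i) u)"
        using assms(1) less.prems by (intro sum_mono2) (auto simp: tree_homs_nonneg)
      finally show ?thesis .
    qed
    then show ?thesis using less Suc
      by (auto intro!: sum_mono mult_mono less.IH sum_nonneg
          simp: treelike_walks_nonneg tree_homs_nonneg)
  qed simp
qed

text \<open>Each edge of a plane tree leaves at most \<open>card V\<close> choices for its lower
  end.\<close>

lemma tree_homs_le:
  assumes "finite V"
  shows "tree_homs E V k v \<le> catalan_real k * real (card V) ^ k"
proof (induction k arbitrary: v rule: less_induct)
  case (less k)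
  show ?case
  proof (cases k)
    case (Suc j)
    let ?n = "real (card V)" and ?N = "{u\<in>V. (v, u) \<in> E}"
    have "tree_homs E V i v * (\<Sum>u\<in>?N. tree_homs E V (j - i) u) \<le>
        catalan_real i * catalan_real (j - i) * ?n ^ Suc j" if "i \<le> j" for i
    proof -
      have "(\<Sum>u\<in>?N. tree_homs E V (j - i) u) \<le> real (card ?N) * (catalan_real (j - i) * ?n ^ (j - i))"
        using Suc by (intro sum_bounded_above less.IH) auto
      also have "\<dots> \<le> ?n * (catalan_real (j - i) * ?n ^ (j - i))"
        using assms by (intro mult_right_mono) (auto intro: card_mono simp: catalan_real_nonneg)
      finally have "tree_homs E V i v * (\<Sum>u\<in>?N. tree_homs E V (j - i) u) \<le>
          (catalan_real i * ?n ^ i) * (?n * (catalan_real (j - i) * ?n ^ (j - i)))"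
        using Suc that by (intro mult_mono less.IH)
          (auto intro!: sum_nonneg mult_nonneg_nonneg simp: catalan_real_nonneg tree_homs_nonneg)
      also have "\<dots> = catalan_real i * catalan_real (j - i) * (?n * ?n ^ (i + (j - i)))"
        by (simp add: power_add mult_ac)
      finally show ?thesis using that by simp
    qed
    then show ?thesis
      unfolding Suc tree_homs.simps catalan_real.simps sum_distrib_right by (intro sum_mono) auto
  qed simp
qed

text \<open>With \<open>n = card V\<close>, a deleted vertex removes one of up to \<open>n\<close>
  choices, so the error gains a factor \<open>1 / n\<close> over the trivial order
  \<open>n^k\<close>. The deleted set \<open>V - W\<close> grows along the recursion, whence a bound
  linear in its size.\<close>

lemma tree_homs_minus_treelike_walks:
  assumes "finite V" "irrefl E" "W \<subseteq> V" "v \<in> W"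
  shows "real (card V) * (tree_homs E V k v - treelike_walks E k W v) \<le>
    walk_error k * (1 + real (card (V - W))) * real (card V) ^ k"
  using assms(3,4)
proof (induction k arbitrary: W v rule: less_induct)
  case (less k)
  show ?case
  proof (cases k)
    case (Suc j)
    define n where "n = real (card V)"
    define a where "a = real (card (V - W))"
    let ?N = "{u\<in>V. (v, u) \<in> E}" and ?M = "{u\<in>W. (v, u) \<in> E}"
    have n: "n \<ge> 0" and a: "a \<ge> 0" by (auto simp: n_def a_def)
    \<comment> \<open>Since \<open>v\<close> lies in \<open>W\<close>, exactly one more vertex gets
      deleted.\<close>
    have "V - (W - {v}) = insert v (V - W)" using less.prems by blast
    then have card': "real (card (V - (W - {v}))) = 1 + a"
      using assms(1) less.prems by (simp add: a_def)
    have step: "n * (tree_homs E V i v * (\<Sum>u\<in>?N. tree_homs E V (j - i) u) -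
        treelike_walks E i W v * (\<Sum>u\<in>?M. treelike_walks E (j - i) (W - {v}) u)) \<le>
        (walk_error i * catalan_real (j - i) +
         catalan_real i * (catalan_real (j - i) + 2 * walk_error (j - i))) * (1 + a) * n ^ Suc j"
      if i: "i \<le> j" for i
    proof -
      define c where "c = catalan_real (j - i) * n ^ (j - i)"
      define e where "e = walk_error (j - i) * n ^ (j - i)"
      have c: "c \<ge> 0" and e: "e \<ge> 0"
        using n by (auto simp: c_def e_def catalan_real_nonneg walk_error_nonneg)
      have t: "tree_homs E V (j - i) u \<le> c" for u
        unfolding c_def n_def by (rule tree_homs_le[OF assms(1)])
      have N: "(\<Sum>u\<in>?N. tree_homs E V (j - i) u) \<le> n * c"
      proof -
        have "(\<Sum>u\<in>?N. tree_homs E V (j - i) u) \<le> real (card ?N) * c"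
          by (intro sum_bounded_above t)
        also have "\<dots> \<le> n * c"
          using assms(1) c unfolding n_def by (intro mult_right_mono) (auto intro: card_mono)
        finally show ?thesis .
      qed
      have M: "(\<Sum>u\<in>?M. n * (tree_homs E V (j - i) u - treelike_walks E (j - i) (W - {v}) u))
          \<le> n * (2 * e * (1 + a))"
      proof -
        have "n * (tree_homs E V (j - i) u - treelike_walks E (j - i) (W - {v}) u) \<le> 2 * e * (1 + a)"
          if "u \<in> ?M" for u
        proof -
          have "n * (tree_homs E V (j - i) u - treelike_walks E (j - i) (W - {v}) u) \<le>
              walk_error (j - i) * (1 + (1 + a)) * n ^ (j - i)"
            unfolding n_def card'[symmetric] using that less.prems assms(2) Suc
            by (intro less.IH) (auto simp: irrefl_def)
          also have "\<dots> = e * (2 + a)" by (simp add: e_def)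
          \<comment> \<open>Restores the factor \<open>1 + a\<close> after the extra deletion; this
            is the origin of the \<open>2\<close> in \<open>walk_error\<close>.\<close>
          also have "\<dots> \<le> e * (2 * (1 + a))" using e a by (intro mult_left_mono) auto
          finally show ?thesis by (simp add: mult_ac)
        qed
        then have "(\<Sum>u\<in>?M. n * (tree_homs E V (j - i) u - treelike_walks E (j - i) (W - {v}) u))
            \<le> real (card ?M) * (2 * e * (1 + a))"
          by (intro sum_bounded_above)
        also have "\<dots> \<le> n * (2 * e * (1 + a))"
          using assms(1) less.prems e a unfolding n_def
          by (intro mult_right_mono) (auto intro: card_mono)
        finally show ?thesis .
      qed
      \<comment> \<open>The neighbours already deleted number at most \<open>a\<close>, and each
        costs at most \<open>c\<close>.\<close>
      have NM: "(\<Sum>u\<in>?N - ?M. tree_homs E V (j - i) u) \<le> (1 + a) * c"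
      proof -
        have "(\<Sum>u\<in>?N - ?M. tree_homs E V (j - i) u) \<le> real (card (?N - ?M)) * c"
          by (intro sum_bounded_above t)
        also have "\<dots> \<le> (1 + a) * c"
        proof (rule mult_right_mono[OF _ c])
          have "card (?N - ?M) \<le> card (V - W)" using assms(1) by (intro card_mono) auto
          then show "real (card (?N - ?M)) \<le> 1 + a" by (simp add: a_def)
        qed
        finally show ?thesis .
      qed
      have "(\<Sum>u\<in>?N. tree_homs E V (j - i) u) =
          (\<Sum>u\<in>?N - ?M. tree_homs E V (j - i) u) + (\<Sum>u\<in>?M. tree_homs E V (j - i) u)"
        using assms(1) less.prems by (intro sum.subset_diff) auto
      then have "n * ((\<Sum>u\<in>?N. tree_homs E V (j - i) u) -
            (\<Sum>u\<in>?M. treelike_walks E (j - i) (W - {v}) u)) =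
          n * (\<Sum>u\<in>?N - ?M. tree_homs E V (j - i) u) +
          (\<Sum>u\<in>?M. n * (tree_homs E V (j - i) u - treelike_walks E (j - i) (W - {v}) u))"
        by (simp add: sum_distrib_left sum_subtractf algebra_simps)
      also have "\<dots> \<le> n * ((1 + a) * c) + n * (2 * e * (1 + a))"
        using M mult_left_mono[OF NM n] by linarith
      finally have inner: "n * ((\<Sum>u\<in>?N. tree_homs E V (j - i) u) -
            (\<Sum>u\<in>?M. treelike_walks E (j - i) (W - {v}) u)) \<le> n * (1 + a) * (c + 2 * e)"
        by (simp add: algebra_simps)
      have outer: "n * (tree_homs E V i v - treelike_walks E i W v) \<le> walk_error i * (1 + a) * n ^ i"
        unfolding n_def a_def using less.prems Suc i by (intro less.IH) auto
      have s: "treelike_walks E i W v \<le> catalan_real i * n ^ i"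
        using treelike_walks_le_tree_homs[OF assms(1) less.prems(1)] tree_homs_le[OF assms(1)]
        unfolding n_def by (rule order_trans)
      \<comment> \<open>A difference of products, split as
        \<open>T * A - S * B = (T - S) * A + S * (A - B)\<close>.\<close>
      have "n * (tree_homs E V i v * (\<Sum>u\<in>?N. tree_homs E V (j - i) u) -
          treelike_walks E i W v * (\<Sum>u\<in>?M. treelike_walks E (j - i) (W - {v}) u)) =
          n * (tree_homs E V i v - treelike_walks E i W v) * (\<Sum>u\<in>?N. tree_homs E V (j - i) u) +
          treelike_walks E i W v * (n * ((\<Sum>u\<in>?N. tree_homs E V (j - i) u) -
            (\<Sum>u\<in>?M. treelike_walks E (j - i) (W - {v}) u)))"
        by (simp add: algebra_simps)
      also have "\<dots> \<le> (walk_error i * (1 + a) * n ^ i) * (n * c) +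
          (catalan_real i * n ^ i) * (n * (1 + a) * (c + 2 * e))"
      proof (rule add_mono)
        show "n * (tree_homs E V i v - treelike_walks E i W v) * (\<Sum>u\<in>?N. tree_homs E V (j - i) u)
            \<le> (walk_error i * (1 + a) * n ^ i) * (n * c)"
          using n a by (intro mult_mono[OF outer N])
            (auto intro!: sum_nonneg mult_nonneg_nonneg simp: tree_homs_nonneg walk_error_nonneg)
        have "treelike_walks E i W v * (n * ((\<Sum>u\<in>?N. tree_homs E V (j - i) u) -
            (\<Sum>u\<in>?M. treelike_walks E (j - i) (W - {v}) u))) \<le>
            treelike_walks E i W v * (n * (1 + a) * (c + 2 * e))"
          by (rule mult_left_mono[OF inner treelike_walks_nonneg])
        also have "\<dots> \<le> (catalan_real i * n ^ i) * (n * (1 + a) * (c + 2 * e))"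
          using n a c e by (intro mult_right_mono[OF s]) auto
        finally show "treelike_walks E i W v * (n * ((\<Sum>u\<in>?N. tree_homs E V (j - i) u) -
            (\<Sum>u\<in>?M. treelike_walks E (j - i) (W - {v}) u))) \<le>
            (catalan_real i * n ^ i) * (n * (1 + a) * (c + 2 * e))" .
      qed
      also have "\<dots> = (walk_error i * catalan_real (j - i) +
         catalan_real i * (catalan_real (j - i) + 2 * walk_error (j - i))) * (1 + a) *
         (n * (n ^ i * n ^ (j - i)))"
        unfolding c_def e_def by (simp add: algebra_simps)
      also have "n * (n ^ i * n ^ (j - i)) = n ^ Suc j"
        using i by (simp flip: power_add)
      finally show ?thesis .
    qed
    have "n * (tree_homs E V k v - treelike_walks E k W v) =
        (\<Sum>i\<le>j. n * (tree_homs E V i v * (\<Sum>u\<in>?N. tree_homs E V (j - i) u) -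
          treelike_walks E i W v * (\<Sum>u\<in>?M. treelike_walks E (j - i) (W - {v}) u)))"
      unfolding Suc tree_homs.simps treelike_walks.simps sum_subtractf[symmetric] sum_distrib_left ..
    also have "\<dots> \<le> (\<Sum>i\<le>j. (walk_error i * catalan_real (j - i) +
         catalan_real i * (catalan_real (j - i) + 2 * walk_error (j - i))) * (1 + a) * n ^ Suc j)"
      by (intro sum_mono step) auto
    also have "\<dots> = walk_error k * (1 + a) * n ^ k"
      unfolding Suc walk_error.simps sum_distrib_right ..
    finally show ?thesis by (simp add: n_def a_def)
  qed simp
qed

text \<open>The case \<open>W = V\<close> summed over all roots: after normalisation the two counts
  differ by \<open>O(1 / n)\<close>.\<close>

lemma sum_tree_homs_minus_treelike_walks:
  assumes "finite V" "irrefl E" "V \<noteq> {}"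
  shows "\<bar>(\<Sum>v\<in>V. tree_homs E V k v) / real (card V) ^ Suc k -
      (\<Sum>v\<in>V. treelike_walks E k V v) / real (card V) ^ Suc k\<bar> \<le> walk_error k / real (card V)"
proof -
  define n where "n = real (card V)"
  define d where "d = (\<Sum>v\<in>V. tree_homs E V k v - treelike_walks E k V v)"
  have n: "n > 0" using assms by (simp add: n_def card_gt_0_iff)
  have "d \<ge> 0" unfolding d_def
    using treelike_walks_le_tree_homs[OF assms(1) subset_refl] by (intro sum_nonneg) simp
  have "n * d = (\<Sum>v\<in>V. n * (tree_homs E V k v - treelike_walks E k V v))"
    by (simp add: d_def sum_distrib_left)
  also have "\<dots> \<le> real (card V) * (walk_error k * n ^ k)"
    using tree_homs_minus_treelike_walks[OF assms(1,2) subset_refl]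
    by (intro sum_bounded_above) (simp add: n_def)
  finally have "n * d \<le> n * (walk_error k * n ^ k)" by (simp add: n_def)
  then have "d \<le> walk_error k * n ^ k" using n by simp
  then have "d / n ^ Suc k \<le> walk_error k / n"
    using n by (simp add: field_simps)
  moreover have "(\<Sum>v\<in>V. tree_homs E V k v) / n ^ Suc k - (\<Sum>v\<in>V. treelike_walks E k V v) / n ^ Suc k
      = d / n ^ Suc k"
    by (simp add: d_def sum_subtractf diff_divide_distrib)
  ultimately show ?thesis using \<open>d \<ge> 0\<close> n unfolding n_def[symmetric] by simp
qed

section \<open>Tree homomorphism densities\<close>

definition rooted_homs :: "nat pair_pre_digraph \<Rightarrow> 'a pair_pre_digraph \<Rightarrow> 'a \<Rightarrow> real" where
  "rooted_homs F G v = real (card {f \<in> graph_homs F G. f 0 = v})"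

text \<open>Finite sums of rooted homomorphism counts over graphs on \<open>{..k}\<close>. The
  common number \<open>k + 1\<close> of vertices gives all summands the same normalisation.
  Agreement is demanded only at vertices of genuine graphs, where such counts can match
  \<open>tree_homs\<close>.\<close>

inductive tree_combination :: "nat \<Rightarrow> ('a pair_pre_digraph \<Rightarrow> 'a \<Rightarrow> real) \<Rightarrow> bool" where
  rooted: "pair_graph F \<Longrightarrow> pverts F = {..k} \<Longrightarrow>
    (\<And>G v. pair_graph G \<Longrightarrow> v \<in> pverts G \<Longrightarrow> \<phi> G v = rooted_homs F G v) \<Longrightarrow> tree_combination k \<phi>"
| zero: "tree_combination k (\<lambda>G v. 0)"
| add: "tree_combination k \<phi> \<Longrightarrow> tree_combination k \<psi> \<Longrightarrow> tree_combination k (\<lambda>G v. \<phi> G v + \<psi> G v)"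

lemma graph_homsI:
  assumes "f \<in> pverts F \<rightarrow>\<^sub>E pverts G" "\<And>x y. (x, y) \<in> parcs F \<Longrightarrow> (f x, f y) \<in> parcs G"
  shows "f \<in> graph_homs F G"
  using assms by (auto simp: graph_homs_def)

lemma finite_graph_homs:
  assumes "finite (pverts F)" "finite (pverts G)"
  shows "finite (graph_homs F G)"
proof (rule finite_subset)
  show "graph_homs F G \<subseteq> pverts F \<rightarrow>\<^sub>E pverts G" unfolding graph_homs_def by (rule Collect_restrict)
  show "finite (pverts F \<rightarrow>\<^sub>E pverts G)" by (intro finite_PiE assms)
qed

lemma pair_graphD:
  assumes "pair_graph G"
  shows pair_graph_finite: "finite (pverts G)"
    and pair_graph_sym: "sym (parcs G)"
    and pair_graph_irrefl: "irrefl (parcs G)"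
    and pair_graph_arcs: "parcs G \<subseteq> pverts G \<times> pverts G"
proof -
  interpret pair_graph G by fact
  show "finite (pverts G)" by simp
  show "sym (parcs G)" using pair_sym_arcs by (simp add: symmetric_def)
  show "irrefl (parcs G)" using pair_no_loops by (fastforce simp: irrefl_def)
  show "parcs G \<subseteq> pverts G \<times> pverts G" by (auto dest: in_arcsD1 in_arcsD2)
qed

lemma pair_graphI:
  assumes "finite V" "E \<subseteq> V \<times> V" "sym E" "irrefl E"
  shows "pair_graph \<lparr>pverts = V, parcs = E\<rparr>"
proof
  show "finite (parcs \<lparr>pverts = V, parcs = E\<rparr>)"
    using assms(1,2) finite_subset[of E "V \<times> V"] by simp
  show "symmetric (with_proj \<lparr>pverts = V, parcs = E\<rparr>)"
    using assms(3) by (simp add: symmetric_def)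
qed (use assms in \<open>auto simp: irrefl_def\<close>)

lemma sum_rooted_homs:
  assumes "pair_graph G" "finite (pverts F)" "0 \<in> pverts F"
  shows "(\<Sum>v\<in>pverts G. rooted_homs F G v) = real (hom_num F G)"
proof -
  have fin: "finite (graph_homs F G)" by (intro finite_graph_homs assms(2) pair_graph_finite[OF assms(1)])
  have "graph_homs F G = (\<Union>v\<in>pverts G. {f \<in> graph_homs F G. f 0 = v})"
    using assms(3) by (auto simp: graph_homs_def)
  then have "hom_num F G = card (\<Union>v\<in>pverts G. {f \<in> graph_homs F G. f 0 = v})"
    by (simp add: hom_num_def)
  also have "\<dots> = (\<Sum>v\<in>pverts G. card {f \<in> graph_homs F G. f 0 = v})"
    using fin pair_graph_finite[OF assms(1)] by (intro card_UN_disjoint) auto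
  finally show ?thesis by (simp add: rooted_homs_def)
qed

section \<open>Grafting rooted graphs\<close>

text \<open>The second graph is shifted past the first, and a new edge joins the two roots; the root
  \<open>0\<close> of \<open>F1\<close> remains the root. This models one summand in the recursion
  of \<open>tree_homs\<close>.\<close>

definition graft :: "nat \<Rightarrow> nat \<Rightarrow> nat pair_pre_digraph \<Rightarrow> nat pair_pre_digraph \<Rightarrow> nat pair_pre_digraph" where
  "graft k l F1 F2 = \<lparr>pverts = {..Suc (k + l)},
     parcs = parcs F1 \<union> map_prod (\<lambda>x. Suc k + x) (\<lambda>x. Suc k + x) ` parcs F2 \<union> {(0, Suc k), (Suc k, 0)}\<rparr>"

lemma pair_graph_graft:
  assumes "pair_graph F1" "pverts F1 = {..k}" "pair_graph F2" "pverts F2 = {..l}"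
  shows "pair_graph (graft k l F1 F2)"
  unfolding graft_def
proof (rule pair_graphI)
  have F1: "parcs F1 \<subseteq> {..k} \<times> {..k}" and F2: "parcs F2 \<subseteq> {..l} \<times> {..l}"
    using pair_graph_arcs[OF assms(1)] pair_graph_arcs[OF assms(3)] assms by auto
  show "parcs F1 \<union> map_prod (\<lambda>x. Suc k + x) (\<lambda>x. Suc k + x) ` parcs F2 \<union> {(0, Suc k), (Suc k, 0)}
      \<subseteq> {..Suc (k + l)} \<times> {..Suc (k + l)}"
    using F1 F2 by (fastforce simp: map_prod_def)
  show "sym (parcs F1 \<union> map_prod (\<lambda>x. Suc k + x) (\<lambda>x. Suc k + x) ` parcs F2 \<union> {(0, Suc k), (Suc k, 0)})"
    using pair_graph_sym[OF assms(1)] pair_graph_sym[OF assms(3)]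
    by (intro sym_Un) (force simp: sym_def map_prod_def image_iff)+
  show "irrefl (parcs F1 \<union> map_prod (\<lambda>x. Suc k + x) (\<lambda>x. Suc k + x) ` parcs F2 \<union> {(0, Suc k), (Suc k, 0)})"
    using pair_graph_irrefl[OF assms(1)] pair_graph_irrefl[OF assms(3)]
    by (auto simp: irrefl_def)
qed simp

text \<open>A homomorphism of the graft is a pair of homomorphisms whose root images are adjacent;
  the restrictions make both components extensional.\<close>

lemma graph_homs_graft_bij:
  assumes F: "pair_graph F1" "pverts F1 = {..k}" "pair_graph F2" "pverts F2 = {..l}"
    and G: "pair_graph G"
  shows "bij_betw (\<lambda>f. (restrict f {..k}, restrict (\<lambda>x. f (Suc k + x)) {..l}))
     {f \<in> graph_homs (graft k l F1 F2) G. f 0 = v}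
     ({f \<in> graph_homs F1 G. f 0 = v} \<times> {g \<in> graph_homs F2 G. (v, g 0) \<in> parcs G})"
proof (rule bij_betw_byWitness[where
      f' = "\<lambda>(f, g). restrict (\<lambda>x. if x \<le> k then f x else g (x - Suc k)) {..Suc (k + l)}"])
  have F1: "parcs F1 \<subseteq> {..k} \<times> {..k}" and F2: "parcs F2 \<subseteq> {..l} \<times> {..l}"
    using pair_graph_arcs[OF F(1)] pair_graph_arcs[OF F(3)] F by auto
  let ?A = "{f \<in> graph_homs (graft k l F1 F2) G. f 0 = v}"
  let ?B = "{f \<in> graph_homs F1 G. f 0 = v} \<times> {g \<in> graph_homs F2 G. (v, g 0) \<in> parcs G}"
  let ?\<Phi> = "\<lambda>f. (restrict f {..k}, restrict (\<lambda>x. f (Suc k + x)) {..l})"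
  let ?\<Psi> = "\<lambda>(f, g). restrict (\<lambda>x. if x \<le> k then f x else g (x - Suc k)) {..Suc (k + l)}"
  show "\<forall>f\<in>?A. ?\<Psi> (?\<Phi> f) = f"
  proof
    fix f assume "f \<in> ?A"
    then have "f \<in> extensional {..Suc (k + l)}" by (auto simp: graph_homs_def graft_def PiE_def)
    then show "?\<Psi> (?\<Phi> f) = f"
      by (auto simp: fun_eq_iff extensional_def restrict_def)
  qed
  show "\<forall>p\<in>?B. ?\<Phi> (?\<Psi> p) = p"
  proof
    fix p assume "p \<in> ?B"
    moreover obtain f g where p: "p = (f, g)" by fastforce
    ultimately have "f \<in> extensional {..k}" "g \<in> extensional {..l}"
      using F by (auto simp: graph_homs_def PiE_def)
    then show "?\<Phi> (?\<Psi> p) = p"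
      unfolding p by (auto simp: fun_eq_iff extensional_def restrict_def)
  qed
  show "?\<Phi> ` ?A \<subseteq> ?B"
  proof (rule image_subsetI)
    fix f assume "f \<in> ?A"
    then have f: "\<And>x. x \<le> Suc (k + l) \<Longrightarrow> f x \<in> pverts G" "f 0 = v"
      and arcs: "\<And>x y. (x, y) \<in> parcs (graft k l F1 F2) \<Longrightarrow> (f x, f y) \<in> parcs G"
      by (auto simp: graph_homs_def graft_def PiE_def Pi_def)
    have a1: "(f x, f y) \<in> parcs G" if "(x, y) \<in> parcs F1" for x y
      using that by (intro arcs) (simp add: graft_def)
    have a2: "(f (Suc k + x), f (Suc k + y)) \<in> parcs G" if "(x, y) \<in> parcs F2" for x y
      using that by (intro arcs) (force simp: graft_def)
    have a3: "(f 0, f (Suc k)) \<in> parcs G" by (intro arcs) (simp add: graft_def)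
    have "restrict f {..k} \<in> graph_homs F1 G"
      using f(1) a1 F1 F by (auto simp: graph_homs_def)
    moreover have "restrict (\<lambda>x. f (Suc k + x)) {..l} \<in> graph_homs F2 G"
      using f(1) a2 F2 F by (auto simp: graph_homs_def)
    ultimately show "?\<Phi> f \<in> ?B" using f(2) a3 by simp
  qed
  show "?\<Psi> ` ?B \<subseteq> ?A"
  proof (rule image_subsetI)
    fix p assume "p \<in> ?B"
    moreover obtain f g where p: "p = (f, g)" by fastforce
    ultimately have f: "\<And>x. x \<le> k \<Longrightarrow> f x \<in> pverts G" "f 0 = v"
        "\<And>x y. (x, y) \<in> parcs F1 \<Longrightarrow> (f x, f y) \<in> parcs G"
      and g: "\<And>x. x \<le> l \<Longrightarrow> g x \<in> pverts G" "(v, g 0) \<in> parcs G"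
        "\<And>x y. (x, y) \<in> parcs F2 \<Longrightarrow> (g x, g y) \<in> parcs G"
      using F by (auto simp: graph_homs_def PiE_def Pi_def)
    let ?h = "restrict (\<lambda>x. if x \<le> k then f x else g (x - Suc k)) {..Suc (k + l)}"
    \<comment> \<open>The new edge consists of two arcs, so adjacency is needed in both
      directions.\<close>
    have "(g 0, v) \<in> parcs G" using g(2) pair_graph_sym[OF G] by (auto dest: symD)
    then have "(?h x, ?h y) \<in> parcs G" if "(x, y) \<in> parcs (graft k l F1 F2)" for x y
      using that f(2,3) g(2,3) F1 F2 by (auto simp: graft_def)
    moreover have "?h \<in> {..Suc (k + l)} \<rightarrow>\<^sub>E pverts G"
      using f(1) g(1) by auto
    then have "?h \<in> pverts (graft k l F1 F2) \<rightarrow>\<^sub>E pverts G" by (simp add: graft_def)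
    ultimately have "?h \<in> graph_homs (graft k l F1 F2) G"
      by (intro graph_homsI)
    then show "?\<Psi> p \<in> ?A" using f(2) by (simp add: p)
  qed
qed

text \<open>Sort the homomorphisms of \<open>F2\<close> by the image \<open>u\<close> of its root, a
  neighbour of \<open>v\<close>.\<close>

lemma rooted_homs_graft:
  assumes F: "pair_graph F1" "pverts F1 = {..k}" "pair_graph F2" "pverts F2 = {..l}"
    and G: "pair_graph G"
  shows "rooted_homs (graft k l F1 F2) G v =
    rooted_homs F1 G v * (\<Sum>u\<in>{u\<in>pverts G. (v, u) \<in> parcs G}. rooted_homs F2 G u)"
proof -
  have fin: "finite (graph_homs F2 G)" using F G by (intro finite_graph_homs pair_graph_finite) auto
  have "{g \<in> graph_homs F2 G. (v, g 0) \<in> parcs G} =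
      (\<Union>u\<in>{u\<in>pverts G. (v, u) \<in> parcs G}. {g \<in> graph_homs F2 G. g 0 = u})"
    using F by (auto simp: graph_homs_def)
  then have "card {g \<in> graph_homs F2 G. (v, g 0) \<in> parcs G} =
      card (\<Union>u\<in>{u\<in>pverts G. (v, u) \<in> parcs G}. {g \<in> graph_homs F2 G. g 0 = u})" by simp
  also have "\<dots> = (\<Sum>u\<in>{u\<in>pverts G. (v, u) \<in> parcs G}. card {g \<in> graph_homs F2 G. g 0 = u})"
    using fin pair_graph_finite[OF G] by (intro card_UN_disjoint) auto
  finally show ?thesis
    unfolding rooted_homs_def bij_betw_same_card[OF graph_homs_graft_bij[OF assms]]
    by (simp add: card_cartesian_product)
qed

text \<open>The expression is bilinear in \<open>\<phi>\<close> and \<open>\<psi>\<close>, so a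
  nested induction reduces it to two single graphs, where it counts homomorphisms of their
  graft.\<close>

lemma tree_combination_graft:
  assumes "tree_combination k \<phi>" "tree_combination l \<psi>"
  shows "tree_combination (Suc (k + l)) (\<lambda>G v. \<phi> G v * (\<Sum>u\<in>{u\<in>pverts G. (v, u) \<in> parcs G}. \<psi> G u))"
  using assms(1)
proof (induction rule: tree_combination.induct)
  case (rooted F1 k \<phi>)
  note F1 = rooted
  from assms(2) show ?case
  proof (induction rule: tree_combination.induct)
    case (rooted F2 l \<psi>)
    show ?case
    proof (rule tree_combination.rooted)
      show "pair_graph (graft k l F1 F2)" using F1 rooted by (intro pair_graph_graft)
      show "pverts (graft k l F1 F2) = {..Suc (k + l)}" by (simp add: graft_def)
      show "\<phi> G v * (\<Sum>u\<in>{u\<in>pverts G. (v, u) \<in> parcs G}. \<psi> G u) = rooted_homs (graft k l F1 F2) G v"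
        if "pair_graph G" "v \<in> pverts G" for G v
        using F1 rooted that by (simp add: rooted_homs_graft)
    qed
  next
    case (add l \<psi> \<psi>')
    then show ?case
      using tree_combination.add by (simp add: sum.distrib distrib_left)
  qed (simp add: tree_combination.zero)
next
  case (add k \<phi> \<phi>')
  then show ?case using tree_combination.add by (simp add: distrib_right)
qed (simp add: tree_combination.zero)

lemma tree_combination_sum:
  assumes "finite I" "\<And>i. i \<in> I \<Longrightarrow> tree_combination k (\<phi> i)"
  shows "tree_combination k (\<lambda>G v. \<Sum>i\<in>I. \<phi> i G v)"
  using assms by (induction rule: finite_induct) (simp_all add: tree_combination.zero tree_combination.add)

lemma tree_combination_tree_homs:
  "tree_combination k (\<lambda>(G :: 'a pair_pre_digraph) v. tree_homs (parcs G) (pverts G) k v)"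
proof (induction k rule: less_induct)
  case (less k)
  show ?case
  proof (cases k)
    case 0
    show ?thesis unfolding 0
    proof (rule tree_combination.rooted)
      \<comment> \<open>The one-vertex tree: exactly one homomorphism sends it to a given vertex
        \<open>v\<close>.\<close>
      let ?F = "\<lparr>pverts = {..0::nat}, parcs = {}\<rparr>"
      show "pair_graph ?F" by (rule pair_graphI) (auto simp: irrefl_def sym_def)
      show "tree_homs (parcs G) (pverts G) 0 v = rooted_homs ?F G v" if "v \<in> pverts G" for G and v :: 'a
      proof -
        have "{f \<in> graph_homs ?F G. f 0 = v} = {\<lambda>x\<in>{..0}. v}"
          using that by (auto simp: graph_homs_def fun_eq_iff PiE_def extensional_def)
        then show ?thesis by (simp add: rooted_homs_def)
      qed
    qed simp
  next
    case (Suc j)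
    \<comment> \<open>Grafting adds one edge to \<open>i + (j - i)\<close>, so all summands share
      the index \<open>Suc j\<close>.\<close>
    have "tree_combination (Suc j) (\<lambda>(G :: 'a pair_pre_digraph) v. tree_homs (parcs G) (pverts G) i v *
        (\<Sum>u\<in>{u\<in>pverts G. (v, u) \<in> parcs G}. tree_homs (parcs G) (pverts G) (j - i) u))"
      if "i \<le> j" for i
    proof -
      have "i < k" "j - i < k" using that Suc by auto
      from tree_combination_graft[OF less.IH[OF this(1)] less.IH[OF this(2)]]
      show ?thesis using that by simp
    qed
    then show ?thesis unfolding Suc tree_homs.simps by (intro tree_combination_sum) auto
  qed
qed

text \<open>Summing over the root image turns a rooted count into \<open>hom_num F (G n)\<close>,
  and \<open>F\<close> has \<open>Suc k\<close> vertices, as in the normalisation of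
  \<open>dense_convergent\<close>.\<close>

lemma tree_combination_convergent:
  assumes "tree_combination k \<phi>" "\<And>n. pair_graph (G n)" "dense_convergent G"
  shows "convergent (\<lambda>n. (\<Sum>v\<in>pverts (G n). \<phi> (G n) v) / real (vert_num (G n)) ^ Suc k)"
  using assms(1)
proof (induction rule: tree_combination.induct)
  case (rooted F k \<phi>)
  have "(\<Sum>v\<in>pverts (G n). \<phi> (G n) v) = real (hom_num F (G n))" for n
    using rooted assms(2) by (simp flip: sum_rooted_homs)
  moreover have "vert_num F = Suc k" using rooted by (simp add: vert_num_def)
  moreover have "convergent (\<lambda>n. real (hom_num F (G n)) / real (vert_num (G n)) ^ vert_num F)"
    using assms(3) rooted(1) unfolding dense_convergent_def by blast
  ultimately show ?case by (simp only:)
next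
  case (add k \<phi> \<psi>)
  show ?case unfolding sum.distrib add_divide_distrib by (rule convergent_add[OF add.IH])
qed (simp add: convergent_const)

section \<open>Weak convergence\<close>

lemma (in real_distribution) bounded_moments:
  assumes "AE x in M. \<bar>x\<bar> \<le> c"
  shows "integrable M (\<lambda>x. x ^ k)" "expectation (\<lambda>x. \<bar>x\<bar> ^ k) \<le> c ^ k"
proof -
  have bound: "AE x in M. \<bar>x\<bar> ^ k \<le> c ^ k"
    using assms by eventually_elim (simp add: power_mono)
  then show "integrable M (\<lambda>x. x ^ k)"
    by (intro integrable_const_bound[of _ "c ^ k"]) (simp_all add: power_abs)
  then have "integrable M (\<lambda>x. \<bar>x\<bar> ^ k)"
    using integrable_abs by (fastforce simp: power_abs)
  then have "expectation (\<lambda>x. \<bar>x\<bar> ^ k) \<le> expectation (\<lambda>x. c ^ k)"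
    using bound by (intro integral_mono_AE) auto
  then show "expectation (\<lambda>x. \<bar>x\<bar> ^ k) \<le> c ^ k" using prob_space by simp
qed

lemma power_div_fact_summable: "summable (\<lambda>k. a ^ k / fact k :: real)"
  using summable_exp[of a] by (simp add: field_simps)

text \<open>For bounded support the Taylor remainder is at most
  \<open>2 * (\<bar>t\<bar> * c)^n / fact n\<close>, which tends to zero.\<close>

lemma (in real_distribution) char_moment_sums:
  assumes "AE x in M. \<bar>x\<bar> \<le> c"
  shows "(\<lambda>k. (\<i> * t) ^ k / fact k * expectation (\<lambda>x. x ^ k)) sums char M t"
  unfolding sums_def_le
proof (rule LIM_zero_cancel, rule Lim_null_comparison)
  show "\<forall>\<^sub>F n in sequentially. norm ((\<Sum>k\<le>n. (\<i> * t) ^ k / fact k * expectation (\<lambda>x. x ^ k)) - char M t)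
      \<le> 2 * ((\<bar>t\<bar> * c) ^ n / fact n)"
  proof (intro always_eventually allI)
    fix n
    have "norm ((\<Sum>k\<le>n. (\<i> * t) ^ k / fact k * expectation (\<lambda>x. x ^ k)) - char M t) \<le>
        (2 * \<bar>t\<bar> ^ n / fact n) * expectation (\<lambda>x. \<bar>x\<bar> ^ n)"
      using char_approx1[of n t, OF bounded_moments(1)[OF assms]] by (simp add: norm_minus_commute)
    also have "\<dots> \<le> (2 * \<bar>t\<bar> ^ n / fact n) * c ^ n"
      by (intro mult_left_mono bounded_moments assms) simp
    finally show "norm ((\<Sum>k\<le>n. (\<i> * t) ^ k / fact k * expectation (\<lambda>x. x ^ k)) - char M t)
        \<le> 2 * ((\<bar>t\<bar> * c) ^ n / fact n)" by (simp add: power_mult_distrib)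
  qed
  show "(\<lambda>n. 2 * ((\<bar>t\<bar> * c) ^ n / fact n)) \<longlonglongrightarrow> 0"
    using tendsto_mult_left[OF summable_LIMSEQ_zero[OF power_div_fact_summable], of 2] by simp
qed

text \<open>Convergent moments make the characteristic functions converge pointwise. Tightness
  provides a subsequential limit \<open>M\<close>, and Levy's continuity theorem extends the
  convergence to the whole sequence.\<close>

lemma bounded_moments_converge_imp_weak_conv:
  fixes \<mu> :: "nat \<Rightarrow> real measure"
  assumes \<mu>: "\<And>n. real_distribution (\<mu> n)" and bound: "\<And>n. AE x in \<mu> n. \<bar>x\<bar> \<le> c"
    and moments: "\<And>k. convergent (\<lambda>n. \<integral>x. x ^ k \<partial>\<mu> n)"
  shows "\<exists>M. real_distribution M \<and> weak_conv_m \<mu> M"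
proof -
  interpret \<mu>: real_distribution "\<mu> n" for n by (rule \<mu>)
  obtain L where L: "\<And>k. (\<lambda>n. \<integral>x. x ^ k \<partial>\<mu> n) \<longlonglongrightarrow> L k"
    using moments unfolding convergent_def by metis
  have char: "\<exists>\<phi>. (\<lambda>n. char (\<mu> n) t) \<longlonglongrightarrow> \<phi>" for t
  proof -
    have sums: "char (\<mu> n) t = (\<Sum>k. (\<i> * t) ^ k / fact k * (\<integral>x. x ^ k \<partial>\<mu> n))" for n
      using \<mu>.char_moment_sums[OF bound] by (rule sums_unique)
    have "norm ((\<i> * t) ^ k / fact k * complex_of_real (\<integral>x. x ^ k \<partial>\<mu> n)) \<le> (\<bar>t\<bar> * c) ^ k / fact k" for k n
    proof -
      have "\<bar>\<integral>x. x ^ k \<partial>\<mu> n\<bar> \<le> (\<integral>x. \<bar>x\<bar> ^ k \<partial>\<mu> n)"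
        using integral_abs_bound[of "\<mu> n" "\<lambda>x. x ^ k"] by (simp add: power_abs)
      also have "\<dots> \<le> c ^ k" by (rule \<mu>.bounded_moments[OF bound])
      finally have "\<bar>t\<bar> ^ k / fact k * \<bar>\<integral>x. x ^ k \<partial>\<mu> n\<bar> \<le> \<bar>t\<bar> ^ k / fact k * c ^ k"
        by (intro mult_left_mono) auto
      then show ?thesis
        by (simp add: norm_mult norm_divide norm_power power_mult_distrib)
    qed
    \<comment> \<open>The summable bound is independent of \<open>n\<close>, so Tannery's theorem
      permits the limit under the series.\<close>
    then have "(\<lambda>n. \<Sum>k. (\<i> * t) ^ k / fact k * complex_of_real (\<integral>x. x ^ k \<partial>\<mu> n))
        \<longlonglongrightarrow> (\<Sum>k. (\<i> * t) ^ k / fact k * complex_of_real (L k))"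
      by (intro tannerys_theorem[THEN conjunct2, THEN conjunct2] power_div_fact_summable
          always_eventually tendsto_mult tendsto_const tendsto_of_real L)
        (auto simp: power_div_fact_summable)
    then show ?thesis unfolding sums by blast
  qed
  have "tight \<mu>" unfolding tight_def
  proof (intro conjI allI impI \<mu>)
    fix \<epsilon> :: real assume "\<epsilon> > 0"
    \<comment> \<open>The extra unit accommodates the open left end, and
      \<open>\<bar>c\<bar>\<close> keeps the interval nonempty whatever the sign of
      \<open>c\<close>.\<close>
    have "measure (\<mu> n) {- \<bar>c\<bar> - 1<..\<bar>c\<bar> + 1} = 1" for n
    proof -
      have "AE x in \<mu> n. x \<in> {- \<bar>c\<bar> - 1<..\<bar>c\<bar> + 1}"
        using bound[of n] by eventually_elim auto
      then show ?thesis by (subst \<mu>.prob_eq_1) auto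
    qed
    then show "\<exists>a b. a < b \<and> (\<forall>n. measure (\<mu> n) {a<..b} > 1 - \<epsilon>)"
      using \<open>\<epsilon> > 0\<close> by (intro exI[of _ "- \<bar>c\<bar> - 1"] exI[of _ "\<bar>c\<bar> + 1"]) auto
  qed
  \<comment> \<open>The subsequence merely supplies a probability measure whose characteristic
    function must be the limit already found.\<close>
  from tight_imp_convergent_subsubsequence[OF this strict_mono_id]
  obtain r M where r: "strict_mono r" and M: "real_distribution M" and weak: "weak_conv_m (\<mu> \<circ> r) M"
    by (auto simp: comp_def)
  have "(\<lambda>n. char (\<mu> n) t) \<longlonglongrightarrow> char M t" for t
  proof -
    obtain \<phi> where \<phi>: "(\<lambda>n. char (\<mu> n) t) \<longlonglongrightarrow> \<phi>" using char by blast
    have "(\<lambda>n. char (\<mu> (r n)) t) \<longlonglongrightarrow> \<phi>"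
      using LIMSEQ_subseq_LIMSEQ[OF \<phi> r] by (simp add: comp_def)
    moreover have "(\<lambda>n. char (\<mu> (r n)) t) \<longlonglongrightarrow> char M t"
      using levy_continuity1[OF _ M weak] \<mu> by (simp add: comp_def)
    ultimately show ?thesis using \<phi> LIMSEQ_unique by blast
  qed
  then have "weak_conv_m \<mu> M" by (intro levy_continuity \<mu> M)
  then show ?thesis using M by blast
qed

lemma sum_mset_eq_sum_count:
  "(\<Sum>a\<in>#R. f a) = (\<Sum>a\<in>set_mset R. real (count R a) * f a)"
proof -
  \<comment> \<open>A fixed finite \<open>A\<close> replaces \<open>set_mset R\<close>, which
    changes along the induction.\<close>
  have "(\<Sum>a\<in>#R. f a) = (\<Sum>a\<in>A. real (count R a) * f a)" if "finite A" "set_mset R \<subseteq> A" for A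
    using that(2)
  proof (induction R)
    case (add b R)
    have "(\<Sum>a\<in>A. real (count (add_mset b R) a) * f a) =
        (\<Sum>a\<in>A. real (count R a) * f a + (if a = b then f a else 0))"
      by (intro sum.cong) (auto simp: algebra_simps)
    then show ?case using add \<open>finite A\<close> by (simp add: sum.distrib)
  qed simp
  then show ?thesis by simp
qed

section \<open>The rescaled root measure of a single graph\<close>

lemma matching_poly_conv_on:
  assumes "pair_graph G"
  shows "matching_poly G = matching_poly_on (parcs G) (pverts G)"
proof -
  have "parcs G \<inter> pverts G \<times> pverts G = parcs G" using pair_graph_arcs[OF assms] by blast
  then have "edge_matchings (parcs G) (pverts G) = matchings G"
    by (cases G) (simp add: edge_matchings_def)
  then show ?thesis by (simp add: matching_poly_def matching_poly_on_def vert_num_def)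
qed

context
  fixes G :: "'a pair_pre_digraph"
  assumes G: "pair_graph G" and nonempty: "vert_num G > 0"
begin

lemma size_proots_matching_poly: "size (proots (matching_poly G)) = vert_num G"
  unfolding matching_poly_conv_on[OF G] vert_num_def
  by (intro matching_poly_on_splits pair_graphD[OF G])

lemma proots_matching_poly_nonempty: "proots (matching_poly G) \<noteq> {#}"
  using size_proots_matching_poly nonempty by auto

text \<open>By Heilmann--Lieb there are as many real roots as vertices, so dividing multiplicities
  by \<open>vert_num G\<close> gives the uniform distribution on the root multiset.\<close>

lemma rescaled_root_measure_eq_distr_pmf:
  "rescaled_root_measure G =
     distr (measure_pmf (pmf_of_multiset (proots (matching_poly G)))) borel (\<lambda>x. x / sqrt (real (vert_num G)))"
proof -
  have "root_measure G = distr (measure_pmf (pmf_of_multiset (proots (matching_poly G)))) borel (\<lambda>x. x)"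
    unfolding root_measure_def measure_pmf_eq_density point_measure_def
    by (simp add: proots_matching_poly_nonempty size_proots_matching_poly)
  then show ?thesis
    by (simp add: rescaled_root_measure_def distr_distr comp_def)
qed

lemma real_distribution_rescaled_root_measure: "real_distribution (rescaled_root_measure G)"
  unfolding rescaled_root_measure_eq_distr_pmf
  by (rule prob_space.real_distribution_distr) (auto simp: measure_pmf.prob_space_axioms)

lemma AE_rescaled_root_measure: "AE x in rescaled_root_measure G. \<bar>x\<bar> \<le> 2"
proof -
  have "\<bar>a\<bar> \<le> 2 * sqrt (real (vert_num G))" if "a \<in># proots (matching_poly G)" for a
  proof -
    have "poly (matching_poly G) a = 0" using that by (cases "matching_poly G = 0") auto
    then show ?thesis
      using abs_root_matching_poly_on_le[OF pair_graphD(1-3)[OF G]]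
      unfolding matching_poly_conv_on[OF G] vert_num_def by blast
  qed
  then show ?thesis
    unfolding rescaled_root_measure_eq_distr_pmf using nonempty
    by (subst AE_distr_iff) (auto simp: AE_measure_pmf_iff proots_matching_poly_nonempty field_simps)
qed

text \<open>For \<open>j = 2 * k\<close> the power sum is divided by
  \<open>n * sqrt n ^ j = n ^ (k + 1)\<close>, the normalisation of trees with \<open>k\<close>
  edges.\<close>

lemma moment_rescaled_root_measure:
  "(\<integral>x. x ^ j \<partial>rescaled_root_measure G) = (if even j then
     (\<Sum>v\<in>pverts G. treelike_walks (parcs G) (j div 2) (pverts G) v) / real (vert_num G) ^ Suc (j div 2)
     else 0)"
proof -
  let ?n = "real (vert_num G)" and ?R = "proots (matching_poly G)"
  have "(\<integral>x. x ^ j \<partial>rescaled_root_measure G) =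
      (\<integral>x. (x / sqrt ?n) ^ j \<partial>measure_pmf (pmf_of_multiset ?R))"
    unfolding rescaled_root_measure_eq_distr_pmf by (subst integral_distr) auto
  also have "\<dots> = (\<Sum>a\<in>set_mset ?R. (a / sqrt ?n) ^ j * pmf (pmf_of_multiset ?R) a)"
    by (rule integral_measure_pmf_real) (auto simp: proots_matching_poly_nonempty)
  also have "\<dots> = (\<Sum>a\<in>set_mset ?R. real (count ?R a) * a ^ j) / (?n * sqrt ?n ^ j)"
    unfolding sum_divide_distrib
    by (intro sum.cong)
      (auto simp: proots_matching_poly_nonempty size_proots_matching_poly power_divide mult.commute)
  also have "(\<Sum>a\<in>set_mset ?R. real (count ?R a) * a ^ j) = (\<Sum>a\<in>#?R. a ^ j)"
    by (rule sum_mset_eq_sum_count[symmetric])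
  also have "\<dots> = (if even j then \<Sum>v\<in>pverts G. treelike_walks (parcs G) (j div 2) (pverts G) v else 0)"
    unfolding matching_poly_conv_on[OF G]
    by (intro power_sum_roots_matching_poly_on pair_graphD[OF G])
  finally show ?thesis by (auto elim!: evenE simp: power_mult)
qed

end

section \<open>Passage to the limit along the graph sequence\<close>

text \<open>Odd moments vanish once there is a vertex; even ones differ from convergent tree
  densities by at most \<open>walk_error k / n\<close>.\<close>

lemma moments_rescaled_root_measure_converge:
  assumes G: "\<And>n. pair_graph (G n)" and lim: "filterlim (\<lambda>n. vert_num (G n)) at_top sequentially"
    and conv: "dense_convergent G"
  shows "convergent (\<lambda>n. \<integral>x. x ^ j \<partial>rescaled_root_measure (G n))"
proof -
  have pos: "\<forall>\<^sub>F n in sequentially. vert_num (G n) > 0"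
    by (rule eventually_compose_filterlim[OF eventually_gt_at_top lim])
  show ?thesis
  proof (cases "even j")
    case False
    have "\<forall>\<^sub>F n in sequentially. (\<integral>x. x ^ j \<partial>rescaled_root_measure (G n)) = 0"
      using pos by eventually_elim (simp add: False moment_rescaled_root_measure[OF G])
    then have "(\<lambda>n. \<integral>x. x ^ j \<partial>rescaled_root_measure (G n)) \<longlonglongrightarrow> 0"
      by (rule tendsto_eventually)
    then show ?thesis by (rule convergentI)
  next
    case True
    define k where "k = j div 2"
    let ?n = "\<lambda>n. real (vert_num (G n))"
    let ?t = "\<lambda>n. (\<Sum>v\<in>pverts (G n). tree_homs (parcs (G n)) (pverts (G n)) k v) / ?n n ^ Suc k"
    let ?m = "\<lambda>n. \<integral>x. x ^ j \<partial>rescaled_root_measure (G n)"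
    obtain L where L: "?t \<longlonglongrightarrow> L"
      using tree_combination_convergent[OF tree_combination_tree_homs G conv, of k]
      unfolding convergent_def by blast
    have bound: "\<forall>\<^sub>F n in sequentially. norm (?t n - ?m n) \<le> walk_error k / ?n n"
      using pos
    proof eventually_elim
      case (elim n)
      then have "pverts (G n) \<noteq> {}" by (auto simp: vert_num_def)
      from sum_tree_homs_minus_treelike_walks
        [OF pair_graph_finite[OF G[of n]] pair_graph_irrefl[OF G[of n]] this, of k]
      show ?case
        by (simp add: moment_rescaled_root_measure[OF G elim] True k_def vert_num_def)
    qed
    have "(\<lambda>n. ?t n - ?m n) \<longlonglongrightarrow> 0"
    proof (rule Lim_null_comparison[OF bound])
      show "(\<lambda>n. walk_error k / ?n n) \<longlonglongrightarrow> 0"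
        using lim by (intro real_tendsto_divide_at_top[OF tendsto_const]
            filterlim_compose[OF filterlim_real_sequentially])
    qed
    from tendsto_diff[OF L this] have "?m \<longlonglongrightarrow> L" by simp
    then show ?thesis by (rule convergentI)
  qed
qed

theorem theorem4p3:
  fixes G :: "nat \<Rightarrow> 'a pair_pre_digraph"
  assumes "\<And>n. pair_graph (G n)"
    and "filterlim (\<lambda>n. vert_num (G n)) at_top sequentially"
    and "dense_convergent G"
  shows "\<exists>M. real_distribution M \<and> weak_conv_m (\<lambda>n. rescaled_root_measure (G n)) M"
proof -
  have "\<forall>\<^sub>F n in sequentially. vert_num (G n) > 0"
    by (rule eventually_compose_filterlim[OF eventually_gt_at_top assms(2)])
  \<comment> \<open>Finitely many graphs may be empty, and their root measure is zero; shifting past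
    them leaves probability measures only.\<close>
  then obtain N where N: "\<And>n. n \<ge> N \<Longrightarrow> vert_num (G n) > 0"
    unfolding eventually_sequentially by blast
  have "\<exists>M. real_distribution M \<and> weak_conv_m (\<lambda>n. rescaled_root_measure (G (n + N))) M"
  proof (rule bounded_moments_converge_imp_weak_conv)
    show "real_distribution (rescaled_root_measure (G (n + N)))" for n
      by (intro real_distribution_rescaled_root_measure assms N) simp
    show "AE x in rescaled_root_measure (G (n + N)). \<bar>x\<bar> \<le> 2" for n
      by (intro AE_rescaled_root_measure assms N) simp
    show "convergent (\<lambda>n. \<integral>x. x ^ k \<partial>rescaled_root_measure (G (n + N)))" for k
      using moments_rescaled_root_measure_converge[OF assms]
      by (rule convergent_ignore_initial_segment[THEN iffD2])
  qed
  then obtain M where M: "real_distribution M"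
    and weak: "weak_conv_m (\<lambda>n. rescaled_root_measure (G (n + N))) M" by blast
  \<comment> \<open>Limits of the distribution functions are insensitive to the first
    \<open>N\<close> terms.\<close>
  have "weak_conv_m (\<lambda>n. rescaled_root_measure (G n)) M"
    unfolding weak_conv_m_def weak_conv_def
  proof (intro allI impI)
    fix x assume "isCont (cdf M) x"
    then have "(\<lambda>n. cdf (rescaled_root_measure (G (n + N))) x) \<longlonglongrightarrow> cdf M x"
      using weak unfolding weak_conv_m_def weak_conv_def by blast
    then show "(\<lambda>n. cdf (rescaled_root_measure (G n)) x) \<longlonglongrightarrow> cdf M x"
      by (rule LIMSEQ_offset)
  qed
  with M show ?thesis by blast
qed

end
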